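(* Let $\mathcal{C}$ be a topological category. Then the topological category $\mathcal{P}\mathcal{C}$, together with the functors $i:\mathcal{C}\to\mathcal{P}\mathcal{C}$ and $(ev_s,ev_t):\mathcal{P}\mathcal{C}\to\mathcal{C}\times\mathcal{C}$, is a path object for $\mathcal{C}$ in the model category $\mathbf{Cat}_{\mathbf{Top}}$; that is, the diagonal $\Delta:\mathcal{C}\to\mathcal{C}\times\mathcal{C}$ factors as $\Delta=(ev_s,ev_t)\circ i$, where $i$ is a weak equivalence and $(ev_s,ev_t)$ is a fibration of $\mathbf{Cat}_{\mathbf{Top}}$.
   Context: $\mathbf{Top}$ is the category of compactly generated topological spaces with its standard (Quillen) model structure (weak homotopy equivalences, Serre fibrations). A topological category is a small category enriched in $\mathbf{Top}$; $\mathbf{Cat}_{\mathbf{Top}}$ is the category of topological categories and enriched functors. For a topological category $\mathcal{C}$, $\pi_0\mathcal{C}$ is the category with the same objects and morphism sets $\pi_0\mathrm{Map}_{\mathcal{C}}(x,y)$. A morphism $a\in\mathrm{Map}_{\mathcal{C}}(x,y)$ is called a weak (homotopy) equivalence in $\mathcal{C}$ if its class in $\pi_0\mathcal{C}$ is an isomorphism. Model structure on $\mathbf{Cat}_{\mathbf{Top}}$: a functor $F:\mathcal{C}\to\mathcal{D}$ is a weak equivalence (Dwyer-Kan equivalence) if $\mathrm{Map}_{\mathcal{C}}(x,y)\to\mathrm{Map}_{\mathcal{D}}(Fx,Fy)$ is a weak homotopy equivalence for all objects $x,y$ and $\pi_0F:\pi_0\mathcal{C}\to\pi_0\mathcal{D}$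 is essentially surjective. $F$ is a fibration if each $\mathrm{Map}_{\mathcal{C}}(x,y)\to\mathrm{Map}_{\mathcal{D}}(Fx,Fy)$ is a Serre fibration and, for every object $x$ of $\mathcal{C}$ and every weak equivalence $e:F(x)\to d$ in $\mathcal{D}$, there is a weak equivalence $\tilde e:x\to x'$ in $\mathcal{C}$ with $F(\tilde e)=e$. Moore paths: with $\mathbb{R}^+=[0,\infty)$, the Moore path space of a space $X$ is the subspace $\mathcal{M}(X)=\{(\alpha,r)\in X^{\mathbb{R}^+}\times\mathbb{R}^+\mid \alpha(s)=\alpha(r)\ \forall s\ge r\}$; $r$ is the length. Put $\delta_-(\alpha,r)=\alpha(0)$ and $\delta_+(\alpha,r)=\alpha(r)$. If $\alpha(r)=\beta(0)$, then $(\alpha,r)$ and $(\beta,s)$ have a concatenation $\beta\ast\alpha$ of length $r+s$ (first $\alpha$ on $[0,r]$, then $\beta$). The topological category $\mathcal{P}\mathcal{C}$: its objects are the morphisms $a:x\to y$ of $\mathcal{C}$ that are weak equivalences in $\mathcal{C}$. For objects $a:x\to y$ and $b:x'\to y'$, the space $\mathrm{Map}_{\mathcal{P}\mathcal{C}}(a,b)$ is the pullback of $(\delta_-,\delta_+):\mathcal{M}(\mathrm{Map}_{\mathcal{C}}(x,y'))\to\mathrm{Map}_{\mathcal{C}}(x,y')\times\mathrm{Map}_{\mathcal{C}}(x,y')$ along the map $\mathrm{Map}_{\mathcal{C}}(x,x')\times\mathrm{Map}_{\mathcal{C}}(y,y')\to\mathrm{Map}_{\mathcal{C}}(x,y')\times\mathrm{Map}_{\mathcal{C}}(x,y')$,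 $(f,g)\mapsto(ga,bf)$. So a morphism $a\to b$ is a triple $(f,g,\alpha)$ with $\alpha$ a Moore path from $ga$ to $bf$. The composite of $(f,g,\alpha):a\to b$ with $(f',g',\beta):b\to c$ is $(f'f,\,g'g,\,(\beta\cdot f)\ast(g'\cdot\alpha))$, where $\beta\cdot f$ and $g'\cdot\alpha$ are obtained by pointwise pre- and post-composition; the identity of $a:x\to y$ is $(\mathrm{id}_x,\mathrm{id}_y,\text{constant path at } a \text{ of length }0)$. The functor $i$ sends $x$ to $\mathrm{id}_x:x\to x$ and $f$ to $(f,f,\text{constant path at } f\text{ of length }0)$. The functors $ev_s,ev_t:\mathcal{P}\mathcal{C}\to\mathcal{C}$ send $a:x\to y$ to $x$ and $y$, and $(f,g,\alpha)$ to $f$ and $g$, respectively. *)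

theory Defs
  imports "HOL-Analysis.Analysis"
begin

section \<open>Compactly generated spaces\<close>

text \<open>
  A space \<open>X\<close> is compactly generated if a set \<open>U\<close> is open in \<open>X\<close> as soon as its preimage under every
  continuous map \<open>t : K \<rightarrow> X\<close> from a compact Hausdorff space \<open>K\<close> is open. HOL cannot quantify over
  spaces of all types, so the points of the test spaces \<open>K\<close> are taken from a type
  that depends on a parameter \<open>'k\<close>, as big as one likes and the same for all spaces under
  consideration; statements are to be made for every \<open>'k\<close>. The summand \<open>real\<close> makes sure that
  all cubes occur among the test spaces, whatever \<open>'k\<close> is.

  No separation axiom is imposed. The library predicate \<^const>\<open>k_space\<close> uses the
  inclusions of all compact subsets, Hausdorff or not. The lemma \<open>cg_space_iff_k_space\<close>
  below shows that both agree on Hausdorff spaces once \<open>'k\<close> is big enough, but without the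
  Hausdorff property the resulting products differ from the usual ones.
\<close>

definition k_open :: "'k itself \<Rightarrow> 'a topology \<Rightarrow> 'a set \<Rightarrow> bool" where
  "k_open T X U \<longleftrightarrow> U \<subseteq> topspace X \<and>
     (\<forall>(K :: ('k + real) topology) t.
        compact_space K \<and> Hausdorff_space K \<and> continuous_map K X t \<longrightarrow>
        openin K {p \<in> topspace K. t p \<in> U})"

definition kify :: "'k itself \<Rightarrow> 'a topology \<Rightarrow> 'a topology" where
  "kify T X = topology (k_open T X)"

definition cg_space :: "'k itself \<Rightarrow> 'a topology \<Rightarrow> bool" where
  "cg_space T X \<longleftrightarrow> (\<forall>U. k_open T X U \<longrightarrow> openin X U)"

lemma istopology_k_open:
  fixes T :: "'k itself" and X :: "'a topology"
  shows "istopology (k_open T X)"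
  unfolding istopology_def
proof (intro conjI allI impI)
  fix S U assume S: "k_open T X S" and U: "k_open T X U"
  show "k_open T X (S \<inter> U)"
    unfolding k_open_def
  proof (intro conjI allI impI)
    show "S \<inter> U \<subseteq> topspace X"
      using S by (auto simp: k_open_def)
    fix K :: "('k + real) topology" and t
    assume K: "compact_space K \<and> Hausdorff_space K \<and> continuous_map K X t"
    have "{p \<in> topspace K. t p \<in> S \<inter> U} = {p \<in> topspace K. t p \<in> S} \<inter> {p \<in> topspace K. t p \<in> U}"
      by auto
    moreover have "openin K {p \<in> topspace K. t p \<in> S}" "openin K {p \<in> topspace K. t p \<in> U}"
      using S U K by (auto simp: k_open_def)
    ultimately show "openin K {p \<in> topspace K. t p \<in> S \<inter> U}"
      by (simp add: openin_Int)
  qed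
next
  fix \<K> assume op: "\<forall>S\<in>\<K>. k_open T X S"
  show "k_open T X (\<Union>\<K>)"
    unfolding k_open_def
  proof (intro conjI allI impI)
    show "\<Union>\<K> \<subseteq> topspace X"
      using op by (auto simp: k_open_def)
    fix K :: "('k + real) topology" and t
    assume K: "compact_space K \<and> Hausdorff_space K \<and> continuous_map K X t"
    have "{p \<in> topspace K. t p \<in> \<Union>\<K>} = \<Union>((\<lambda>S. {p \<in> topspace K. t p \<in> S}) ` \<K>)"
      by auto
    moreover have "openin K (\<Union>((\<lambda>S. {p \<in> topspace K. t p \<in> S}) ` \<K>))"
      using op K by (intro openin_Union) (auto simp: k_open_def)
    ultimately show "openin K {p \<in> topspace K. t p \<in> \<Union>\<K>}"
      by simp
  qed
qed

lemma openin_kify: "openin (kify T X) U \<longleftrightarrow> k_open T X U"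
  by (simp add: kify_def istopology_k_open topology_inverse')

lemma k_open_if_openin: "openin X U \<Longrightarrow> k_open T X U"
  by (auto simp: k_open_def openin_subset continuous_map_def)

lemma topspace_kify [simp]: "topspace (kify T X) = topspace X"
proof (rule antisym)
  show "topspace (kify T X) \<subseteq> topspace X"
    using openin_topspace[of "kify T X"] unfolding openin_kify k_open_def by blast
  show "topspace X \<subseteq> topspace (kify T X)"
    by (intro openin_subset) (simp add: openin_kify k_open_if_openin)
qed

lemma cg_space_iff_k_space:
  fixes X :: "'a topology" and e :: "'a \<Rightarrow> 'k"
  assumes X: "Hausdorff_space X" and e: "inj e"
  shows "cg_space TYPE('k) X \<longleftrightarrow> k_space X"
proof -
  have "k_open TYPE('k) X U \<longleftrightarrow> (\<forall>C. compactin X C \<longrightarrow> openin (subtopology X C) (C \<inter> U))"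
    if U: "U \<subseteq> topspace X" for U
  proof (intro iffI allI impI)
    fix C assume op: "k_open TYPE('k) X U" and C: "compactin X C"
    define S where "S = subtopology X C"
    define j where "j = (\<lambda>c. Inl (e c) :: 'k + real)"
    have "inj j"
      using e by (auto simp: j_def inj_on_def)
    then have inv: "inv j (j c) = c" for c
      by simp
    define K where "K = pullback_topology (j ` topspace S) (inv j) S"
    have "topspace K = j ` topspace S"
      using inv by (auto simp: K_def topspace_pullback_topology)
    have homeo: "homeomorphic_maps S K j (inv j)"
      unfolding homeomorphic_maps_def
    proof (intro conjI)
      show "continuous_map S K j"
        unfolding K_def
        by (intro continuous_map_pullback') (auto simp: comp_def inv)
      show "continuous_map K S (inv j)"
        using continuous_map_pullback[of S S id "j ` topspace S" "inv j"] by (simp add: K_def)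
    qed (auto simp: inv \<open>topspace K = j ` topspace S\<close>)
    then have "S homeomorphic_space K"
      unfolding homeomorphic_space_def by blast
    moreover have "compact_space S" "Hausdorff_space S"
      using C X by (auto simp: S_def compact_space_subtopology Hausdorff_space_subtopology)
    ultimately have "compact_space K" "Hausdorff_space K"
      using homeomorphic_compact_space homeomorphic_Hausdorff_space by blast+
    moreover have "continuous_map K X (inv j)"
      using homeo by (auto simp: homeomorphic_maps_def S_def continuous_map_in_subtopology)
    ultimately have "openin K {p \<in> topspace K. inv j p \<in> U}"
      using op by (simp add: k_open_def)
    then have "openin S {c \<in> topspace S. j c \<in> {p \<in> topspace K. inv j p \<in> U}}"
      using homeo by (intro openin_continuous_map_preimage[of S K]) (auto simp: homeomorphic_maps_def)
    moreover have "{c \<in> topspace S. j c \<in> {p \<in> topspace K. inv j p \<in> U}} = C \<inter> U"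
      using U C by (auto simp: \<open>topspace K = j ` topspace S\<close> inv S_def)
    ultimately show "openin (subtopology X C) (C \<inter> U)"
      by (simp add: S_def)
  next
    assume op: "\<forall>C. compactin X C \<longrightarrow> openin (subtopology X C) (C \<inter> U)"
    show "k_open TYPE('k) X U"
      unfolding k_open_def
    proof (intro conjI allI impI U)
      fix K :: "('k + real) topology" and t
      assume K: "compact_space K \<and> Hausdorff_space K \<and> continuous_map K X t"
      let ?C = "t ` topspace K"
      have "compactin X ?C"
        using K image_compactin compact_space_def by blast
      then have "openin (subtopology X ?C) (?C \<inter> U)"
        using op by blast
      moreover have "continuous_map K (subtopology X ?C) t"
        using K by (simp add: continuous_map_in_subtopology)
      ultimately have "openin K {p \<in> topspace K. t p \<in> ?C \<inter> U}"
        by (rule openin_continuous_map_preimage[rotated])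
      moreover have "{p \<in> topspace K. t p \<in> ?C \<inter> U} = {p \<in> topspace K. t p \<in> U}"
        by auto
      ultimately show "openin K {p \<in> topspace K. t p \<in> U}"
        by simp
    qed
  qed
  then show ?thesis
    unfolding cg_space_def k_space_open by (metis k_open_def)
qed

text \<open>
  Limits of compactly generated spaces are obtained by applying \<^const>\<open>kify\<close> to the limits of
  the underlying topological spaces.
\<close>

definition kprod :: "'k itself \<Rightarrow> 'a topology \<Rightarrow> 'b topology \<Rightarrow> ('a \<times> 'b) topology" where
  "kprod T X Y = kify T (prod_topology X Y)"

definition ksub :: "'k itself \<Rightarrow> 'a topology \<Rightarrow> 'a set \<Rightarrow> 'a topology" where
  "ksub T X S = kify T (subtopology X S)"

definition kpullback ::
  "'k itself \<Rightarrow> 'a topology \<Rightarrow> 'b topology \<Rightarrow> ('a \<Rightarrow> 'c) \<Rightarrow> ('b \<Rightarrow> 'c) \<Rightarrow> ('a \<times> 'b) topology" where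
  "kpullback T X Y u v = ksub T (kprod T X Y) {(x, y). u x = v y}"


section \<open>Weak homotopy equivalences and Serre fibrations\<close>

definition cube :: "nat \<Rightarrow> (nat \<Rightarrow> real) topology" where
  "cube n = product_topology (\<lambda>_. top_of_set {0..1}) {..<n}"

definition cube_boundary :: "nat \<Rightarrow> (nat \<Rightarrow> real) set" where
  "cube_boundary n = {p \<in> topspace (cube n). \<exists>i<n. p i = 0 \<or> p i = 1}"

definition spheroids :: "nat \<Rightarrow> 'a topology \<Rightarrow> 'a \<Rightarrow> ((nat \<Rightarrow> real) \<Rightarrow> 'a) set" where
  "spheroids n X x = {s. continuous_map (cube n) X s \<and> (\<forall>p \<in> cube_boundary n. s p = x)}"

definition spheroid_htpy ::
  "nat \<Rightarrow> 'a topology \<Rightarrow> 'a \<Rightarrow> (((nat \<Rightarrow> real) \<Rightarrow> 'a) \<times> ((nat \<Rightarrow> real) \<Rightarrow> 'a)) set" where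
  "spheroid_htpy n X x = {(s, s'). s \<in> spheroids n X x \<and> s' \<in> spheroids n X x \<and>
     homotopic_with (\<lambda>h. \<forall>p \<in> cube_boundary n. h p = x) (cube n) X s s'}"

definition homotopy_group :: "nat \<Rightarrow> 'a topology \<Rightarrow> 'a \<Rightarrow> ((nat \<Rightarrow> real) \<Rightarrow> 'a) set set" where
  "homotopy_group n X x = spheroids n X x // spheroid_htpy n X x"

text \<open>
  The group structure is not needed: the induced maps are homomorphisms, so they are isomorphisms
  as soon as they are bijective.
\<close>

definition homotopy_group_map ::
  "nat \<Rightarrow> 'b topology \<Rightarrow> ('a \<Rightarrow> 'b) \<Rightarrow> 'a \<Rightarrow> ((nat \<Rightarrow> real) \<Rightarrow> 'a) set \<Rightarrow> ((nat \<Rightarrow> real) \<Rightarrow> 'b) set" where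
  "homotopy_group_map n Y f x A = (\<Union>s\<in>A. spheroid_htpy n Y (f x) `` {f \<circ> s})"

definition path_components_map :: "'b topology \<Rightarrow> ('a \<Rightarrow> 'b) \<Rightarrow> 'a set \<Rightarrow> 'b set" where
  "path_components_map Y f A = (\<Union>a\<in>A. path_component_of_set Y (f a))"

definition weak_homotopy_equivalence :: "'a topology \<Rightarrow> 'b topology \<Rightarrow> ('a \<Rightarrow> 'b) \<Rightarrow> bool" where
  "weak_homotopy_equivalence X Y f \<longleftrightarrow>
     continuous_map X Y f \<and>
     bij_betw (path_components_map Y f) (path_components_of X) (path_components_of Y) \<and>
     (\<forall>n\<ge>1. \<forall>x \<in> topspace X.
        bij_betw (homotopy_group_map n Y f x) (homotopy_group n X x) (homotopy_group n Y (f x)))"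

definition serre_fibration :: "'a topology \<Rightarrow> 'b topology \<Rightarrow> ('a \<Rightarrow> 'b) \<Rightarrow> bool" where
  "serre_fibration X Y f \<longleftrightarrow>
     continuous_map X Y f \<and>
     (\<forall>n g h. continuous_map (cube n) X g \<and>
        continuous_map (prod_topology (cube n) (top_of_set {0..1::real})) Y h \<and>
        (\<forall>p \<in> topspace (cube n). h (p, 0) = f (g p)) \<longrightarrow>
        (\<exists>H. continuous_map (prod_topology (cube n) (top_of_set {0..1})) X H \<and>
           (\<forall>p \<in> topspace (cube n). H (p, 0) = g p) \<and>
           (\<forall>p \<in> topspace (cube n). \<forall>t \<in> {0..1}. f (H (p, t)) = h (p, t))))"


section \<open>Topological categories\<close>

text \<open>
  Mapping spaces of different pairs of objects may overlap, so composition and functors take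
  the objects as arguments; \<open>Comp \<C> x y z g f\<close> is the composite of \<open>f : x \<rightarrow> y\<close> and
  \<open>g : y \<rightarrow> z\<close>.
\<close>

record ('o, 'm) tcat =
  Ob :: "'o set"
  Map :: "'o \<Rightarrow> 'o \<Rightarrow> 'm topology"
  Id :: "'o \<Rightarrow> 'm"
  Comp :: "'o \<Rightarrow> 'o \<Rightarrow> 'o \<Rightarrow> 'm \<Rightarrow> 'm \<Rightarrow> 'm"

definition topological_category :: "'k itself \<Rightarrow> ('o, 'm) tcat \<Rightarrow> bool" where
  "topological_category T \<C> \<longleftrightarrow>
     (\<forall>x\<in>Ob \<C>. \<forall>y\<in>Ob \<C>. cg_space T (Map \<C> x y)) \<and>
     (\<forall>x\<in>Ob \<C>. Id \<C> x \<in> topspace (Map \<C> x x)) \<and>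
     (\<forall>x\<in>Ob \<C>. \<forall>y\<in>Ob \<C>. \<forall>z\<in>Ob \<C>.
        continuous_map (kprod T (Map \<C> y z) (Map \<C> x y)) (Map \<C> x z)
          (\<lambda>(g, f). Comp \<C> x y z g f)) \<and>
     (\<forall>x\<in>Ob \<C>. \<forall>y\<in>Ob \<C>. \<forall>f \<in> topspace (Map \<C> x y).
        Comp \<C> x x y f (Id \<C> x) = f \<and> Comp \<C> x y y (Id \<C> y) f = f) \<and>
     (\<forall>w\<in>Ob \<C>. \<forall>x\<in>Ob \<C>. \<forall>y\<in>Ob \<C>. \<forall>z\<in>Ob \<C>.
        \<forall>f \<in> topspace (Map \<C> w x). \<forall>g \<in> topspace (Map \<C> x y). \<forall>h \<in> topspace (Map \<C> y z).
          Comp \<C> w x z (Comp \<C> x y z h g) f = Comp \<C> w y z h (Comp \<C> w x y g f))"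

record ('o, 'm, 'p, 'n) tfun =
  F0 :: "'o \<Rightarrow> 'p"
  F1 :: "'o \<Rightarrow> 'o \<Rightarrow> 'm \<Rightarrow> 'n"

definition enriched_functor ::
  "'k itself \<Rightarrow> ('o, 'm) tcat \<Rightarrow> ('p, 'n) tcat \<Rightarrow> ('o, 'm, 'p, 'n) tfun \<Rightarrow> bool" where
  "enriched_functor T \<C> \<D> F \<longleftrightarrow>
     topological_category T \<C> \<and> topological_category T \<D> \<and>
     (\<forall>x\<in>Ob \<C>. F0 F x \<in> Ob \<D>) \<and>
     (\<forall>x\<in>Ob \<C>. \<forall>y\<in>Ob \<C>. continuous_map (Map \<C> x y) (Map \<D> (F0 F x) (F0 F y)) (F1 F x y)) \<and>
     (\<forall>x\<in>Ob \<C>. F1 F x x (Id \<C> x) = Id \<D> (F0 F x)) \<and>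
     (\<forall>x\<in>Ob \<C>. \<forall>y\<in>Ob \<C>. \<forall>z\<in>Ob \<C>.
        \<forall>f \<in> topspace (Map \<C> x y). \<forall>g \<in> topspace (Map \<C> y z).
          F1 F x z (Comp \<C> x y z g f) =
            Comp \<D> (F0 F x) (F0 F y) (F0 F z) (F1 F y z g) (F1 F x y f))"

definition functors_agree ::
  "('o, 'm) tcat \<Rightarrow> ('o, 'm, 'p, 'n) tfun \<Rightarrow> ('o, 'm, 'p, 'n) tfun \<Rightarrow> bool" where
  "functors_agree \<C> F G \<longleftrightarrow>
     (\<forall>x\<in>Ob \<C>. F0 F x = F0 G x) \<and>
     (\<forall>x\<in>Ob \<C>. \<forall>y\<in>Ob \<C>. \<forall>f \<in> topspace (Map \<C> x y). F1 F x y f = F1 G x y f)"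

definition functor_comp ::
  "('p, 'n, 'q, 'l) tfun \<Rightarrow> ('o, 'm, 'p, 'n) tfun \<Rightarrow> ('o, 'm, 'q, 'l) tfun" where
  "functor_comp G F = \<lparr>F0 = \<lambda>x. F0 G (F0 F x),
     F1 = \<lambda>x y f. F1 G (F0 F x) (F0 F y) (F1 F x y f)\<rparr>"

definition prod_cat ::
  "'k itself \<Rightarrow> ('o, 'm) tcat \<Rightarrow> ('p, 'n) tcat \<Rightarrow> ('o \<times> 'p, 'm \<times> 'n) tcat" where
  "prod_cat T \<C> \<D> = \<lparr>
     Ob = Ob \<C> \<times> Ob \<D>,
     Map = \<lambda>(x, y) (x', y'). kprod T (Map \<C> x x') (Map \<D> y y'),
     Id = \<lambda>(x, y). (Id \<C> x, Id \<D> y),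
     Comp = \<lambda>(x, y) (x', y') (x'', y'') (f', g') (f, g).
       (Comp \<C> x x' x'' f' f, Comp \<D> y y' y'' g' g)\<rparr>"

definition pair_functor ::
  "('o, 'm, 'p, 'n) tfun \<Rightarrow> ('o, 'm, 'q, 'l) tfun \<Rightarrow> ('o, 'm, 'p \<times> 'q, 'n \<times> 'l) tfun" where
  "pair_functor F G = \<lparr>F0 = \<lambda>x. (F0 F x, F0 G x), F1 = \<lambda>x y f. (F1 F x y f, F1 G x y f)\<rparr>"

definition diagonal_functor :: "('o, 'm, 'o \<times> 'o, 'm \<times> 'm) tfun" where
  "diagonal_functor = \<lparr>F0 = \<lambda>x. (x, x), F1 = \<lambda>x y f. (f, f)\<rparr>"


section \<open>The category of components\<close>

record ('o, 'h) cat =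
  obj :: "'o set"
  hom_set :: "'o \<Rightarrow> 'o \<Rightarrow> 'h set"
  ident :: "'o \<Rightarrow> 'h"
  compose :: "'o \<Rightarrow> 'o \<Rightarrow> 'o \<Rightarrow> 'h \<Rightarrow> 'h \<Rightarrow> 'h"

definition is_iso :: "('o, 'h) cat \<Rightarrow> 'o \<Rightarrow> 'o \<Rightarrow> 'h \<Rightarrow> bool" where
  "is_iso A x y u \<longleftrightarrow> x \<in> obj A \<and> y \<in> obj A \<and> u \<in> hom_set A x y \<and>
     (\<exists>v \<in> hom_set A y x. compose A x y x v u = ident A x \<and> compose A y x y u v = ident A y)"

definition essentially_surjective :: "('o, 'h) cat \<Rightarrow> ('p, 'i) cat \<Rightarrow> ('o \<Rightarrow> 'p) \<Rightarrow> bool" where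
  "essentially_surjective A B F \<longleftrightarrow> (\<forall>d \<in> obj B. \<exists>c \<in> obj A. \<exists>u. is_iso B (F c) d u)"

text \<open>The union over all representatives is the path component of any one composite.\<close>

definition pi0_cat :: "('o, 'm) tcat \<Rightarrow> ('o, 'm set) cat" where
  "pi0_cat \<C> = \<lparr>
     obj = Ob \<C>,
     hom_set = \<lambda>x y. path_components_of (Map \<C> x y),
     ident = \<lambda>x. path_component_of_set (Map \<C> x x) (Id \<C> x),
     compose = \<lambda>x y z B A.
       \<Union>g\<in>B. \<Union>f\<in>A. path_component_of_set (Map \<C> x z) (Comp \<C> x y z g f)\<rparr>"

definition weak_equivalence_in :: "('o, 'm) tcat \<Rightarrow> 'o \<Rightarrow> 'o \<Rightarrow> 'm \<Rightarrow> bool" where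
  "weak_equivalence_in \<C> x y a \<longleftrightarrow>
     x \<in> Ob \<C> \<and> y \<in> Ob \<C> \<and> a \<in> topspace (Map \<C> x y) \<and>
     is_iso (pi0_cat \<C>) x y (path_component_of_set (Map \<C> x y) a)"


section \<open>Weak equivalences, fibrations and path objects of topological categories\<close>

definition dk_equivalence ::
  "'k itself \<Rightarrow> ('o, 'm) tcat \<Rightarrow> ('p, 'n) tcat \<Rightarrow> ('o, 'm, 'p, 'n) tfun \<Rightarrow> bool" where
  "dk_equivalence T \<C> \<D> F \<longleftrightarrow>
     enriched_functor T \<C> \<D> F \<and>
     (\<forall>x\<in>Ob \<C>. \<forall>y\<in>Ob \<C>.
        weak_homotopy_equivalence (Map \<C> x y) (Map \<D> (F0 F x) (F0 F y)) (F1 F x y)) \<and>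
     essentially_surjective (pi0_cat \<C>) (pi0_cat \<D>) (F0 F)"

definition cat_fibration ::
  "'k itself \<Rightarrow> ('o, 'm) tcat \<Rightarrow> ('p, 'n) tcat \<Rightarrow> ('o, 'm, 'p, 'n) tfun \<Rightarrow> bool" where
  "cat_fibration T \<C> \<D> F \<longleftrightarrow>
     enriched_functor T \<C> \<D> F \<and>
     (\<forall>x\<in>Ob \<C>. \<forall>y\<in>Ob \<C>.
        serre_fibration (Map \<C> x y) (Map \<D> (F0 F x) (F0 F y)) (F1 F x y)) \<and>
     (\<forall>x\<in>Ob \<C>. \<forall>d e. weak_equivalence_in \<D> (F0 F x) d e \<longrightarrow>
        (\<exists>x' e'. weak_equivalence_in \<C> x x' e' \<and> F0 F x' = d \<and> F1 F x x' e' = e))"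

definition path_object ::
  "'k itself \<Rightarrow> ('o, 'm) tcat \<Rightarrow> ('p, 'n) tcat \<Rightarrow>
   ('o, 'm, 'p, 'n) tfun \<Rightarrow> ('p, 'n, 'o \<times> 'o, 'm \<times> 'm) tfun \<Rightarrow> bool" where
  "path_object T \<C> \<P> i q \<longleftrightarrow>
     functors_agree \<C> (functor_comp q i) diagonal_functor \<and>
     dk_equivalence T \<C> \<P> i \<and>
     cat_fibration T \<P> (prod_cat T \<C> \<C>) q"


section \<open>Moore paths\<close>

text \<open>Maps on the half line are made extensional so that they are determined by their values there.\<close>

type_synonym 'a moore_path = "(real \<Rightarrow> 'a) \<times> real"

abbreviation half_line :: "real topology" where
  "half_line \<equiv> top_of_set {0..}"

definition compact_open :: "'b topology \<Rightarrow> 'a topology \<Rightarrow> ('b \<Rightarrow> 'a) topology" where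
  "compact_open Y X = topology_generated_by
     {{\<alpha> \<in> extensional (topspace Y). continuous_map Y X \<alpha> \<and> \<alpha> ` C \<subseteq> U} | C U.
        compactin Y C \<and> openin X U}"

text \<open>
  As the half line is Hausdorff, applying \<^const>\<open>kify\<close> to the compact-open topology gives the
  function space from the half line in the category of compactly generated spaces.
\<close>

definition moore_space :: "'k itself \<Rightarrow> 'a topology \<Rightarrow> 'a moore_path topology" where
  "moore_space T X =
     ksub T (kprod T (kify T (compact_open half_line X)) half_line) {(\<alpha>, r). \<forall>s\<ge>r. \<alpha> s = \<alpha> r}"

definition moore_start :: "'a moore_path \<Rightarrow> 'a" where
  "moore_start = (\<lambda>(\<alpha>, r). \<alpha> 0)"

definition moore_end :: "'a moore_path \<Rightarrow> 'a" where
  "moore_end = (\<lambda>(\<alpha>, r). \<alpha> r)"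

definition moore_const :: "'a \<Rightarrow> 'a moore_path" where
  "moore_const x = (\<lambda>u\<in>{0..}. x, 0)"

definition moore_map :: "('a \<Rightarrow> 'b) \<Rightarrow> 'a moore_path \<Rightarrow> 'b moore_path" where
  "moore_map h = (\<lambda>(\<alpha>, r). (\<lambda>u\<in>{0..}. h (\<alpha> u), r))"

text \<open>\<open>moore_concat \<beta> \<alpha>\<close> first runs through \<open>\<alpha>\<close> and then through \<open>\<beta>\<close>.\<close>

definition moore_concat :: "'a moore_path \<Rightarrow> 'a moore_path \<Rightarrow> 'a moore_path" where
  "moore_concat = (\<lambda>(\<beta>, s) (\<alpha>, r).
     (\<lambda>u\<in>{0..}. if u \<le> r then \<alpha> u else \<beta> (u - r), r + s))"


section \<open>The path category\<close>

text \<open>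
  The object \<open>(x, y, a)\<close> stands for the weak equivalence \<open>a : x \<rightarrow> y\<close>.
  The morphism \<open>((f, g), \<alpha>)\<close> stands for the triple \<open>(f, g, \<alpha>)\<close>.
\<close>

type_synonym 'm path_mor = "('m \<times> 'm) \<times> 'm moore_path"

definition path_cat ::
  "'k itself \<Rightarrow> ('o, 'm) tcat \<Rightarrow> ('o \<times> 'o \<times> 'm, 'm path_mor) tcat" where
  "path_cat T \<C> = \<lparr>
     Ob = {(x, y, a). weak_equivalence_in \<C> x y a},
     Map = \<lambda>(x, y, a) (x', y', b).
       kpullback T (kprod T (Map \<C> x x') (Map \<C> y y')) (moore_space T (Map \<C> x y'))
         (\<lambda>(f, g). (Comp \<C> x y y' g a, Comp \<C> x x' y' b f))
         (\<lambda>\<alpha>. (moore_start \<alpha>, moore_end \<alpha>)),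
     Id = \<lambda>(x, y, a). ((Id \<C> x, Id \<C> y), moore_const a),
     Comp = \<lambda>(x, y, a) (x', y', b) (x'', y'', c) ((f', g'), \<beta>) ((f, g), \<alpha>).
       ((Comp \<C> x x' x'' f' f, Comp \<C> y y' y'' g' g),
        moore_concat (moore_map (\<lambda>h. Comp \<C> x x' y'' h f) \<beta>)
                     (moore_map (\<lambda>h. Comp \<C> x y' y'' g' h) \<alpha>))\<rparr>"

definition path_incl :: "('o, 'm) tcat \<Rightarrow> ('o, 'm, 'o \<times> 'o \<times> 'm, 'm path_mor) tfun" where
  "path_incl \<C> = \<lparr>F0 = \<lambda>x. (x, x, Id \<C> x), F1 = \<lambda>x y f. ((f, f), moore_const f)\<rparr>"

definition ev_s :: "('o \<times> 'o \<times> 'm, 'm path_mor, 'o, 'm) tfun" where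
  "ev_s = \<lparr>F0 = \<lambda>(x, y, a). x, F1 = \<lambda>_ _ ((f, g), \<alpha>). f\<rparr>"

definition ev_t :: "('o \<times> 'o \<times> 'm, 'm path_mor, 'o, 'm) tfun" where
  "ev_t = \<lparr>F0 = \<lambda>(x, y, a). y, F1 = \<lambda>_ _ ((f, g), \<alpha>). g\<rparr>"

end

theory Submission
  imports Defs
begin

text \<open>
  A morphism from \<open>id\<^sub>x\<close> to \<open>id\<^sub>y\<close> in the path category is just a Moore path in the mapping space
  from \<open>x\<close> to \<open>y\<close>; contracting the path to its end makes the inclusion of the constant paths a strong
  deformation retract. Homotopies of the source and target components lift because Moore paths can
  be prolonged at both ends by the given homotopies.

  A morphism \<open>(f, g, \<alpha>)\<close> is a weak equivalence in the path category as soon as \<open>f\<close> and \<open>g\<close> are weak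
  equivalences. Indeed, with homotopy inverses of \<open>f\<close> and \<open>g\<close> one builds a morphism in the opposite
  direction; by the lifting property, both composites are homotopic to morphisms of the form
  \<open>(id, id, \<delta>)\<close> with a loop \<open>\<delta>\<close>, and these are inverted by the reverse loop. This gives the
  essential surjectivity of the inclusion, and the lifting of weak equivalences: \<open>(f, g)\<close> starting at
  \<open>a\<close> lifts to a morphism from \<open>a\<close> to \<open>g a f'\<close>, where \<open>f'\<close> is a homotopy inverse of \<open>f\<close>.
\<close>

section \<open>Test spaces\<close>

text \<open>The mapping spaces are limits of compactly generated spaces, so their topologies are
  k-ifications, whose open sets are not accessible directly. They are therefore only probed. A map
  out of such a space is tested on compact Hausdorff spaces. A map from a test space
  \<open>A\<close> into it splits into components for the ordinary product and subspace topologies,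
  and a family of Moore paths over \<open>A\<close> becomes an ordinary map on the product of
  \<open>A\<close> with the half line. Cubes, the interval and their products are test spaces too,
  so homotopies, spheroids and lifting problems are treated in the same way as the structure maps.

  The variable length of Moore paths matters twice. Lengths add under concatenation and constants
  have length 0, so the category axioms hold strictly and not only up to reparametrization. And a
  path prolonged by pieces of length 0 is literally the old path, which gives lifts with the
  prescribed initial value.\<close>

lemma cg_space_kify:
  fixes T :: "'k itself"
  shows "cg_space T (kify T X)"
  unfolding cg_space_def
proof (intro allI impI)
  fix U assume U: "k_open T (kify T X) U"
  have "continuous_map K (kify T X) t"
    if "compact_space K" "Hausdorff_space K" "continuous_map K X t" for K :: "('k + real) topology" and t
    using that by (simp add: continuous_map_def openin_kify k_open_def)
  then show "openin (kify T X) U"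
    using U unfolding openin_kify k_open_def by auto
qed

text \<open>Universal property of the k-ification: composing a test map of \<open>A\<close> with
  \<open>f\<close> gives a test map of \<open>X\<close>, so preimages of k-open sets are k-open,
  hence open in \<open>A\<close>.\<close>

lemma continuous_map_into_kify:
  fixes T :: "'k itself"
  assumes "cg_space T A"
  shows "continuous_map A (kify T X) f \<longleftrightarrow> continuous_map A X f"
proof
  assume "continuous_map A (kify T X) f"
  then show "continuous_map A X f"
    unfolding continuous_map_def by (simp add: openin_kify k_open_if_openin)
next
  assume f: "continuous_map A X f"
  show "continuous_map A (kify T X) f"
    unfolding continuous_map_def
  proof (intro conjI allI impI)
    show "f \<in> topspace A \<rightarrow> topspace (kify T X)"
      using continuous_map_funspace[OF f] by simp
    fix U assume "openin (kify T X) U"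
    then have U: "k_open T X U"
      by (simp add: openin_kify)
    have "k_open T A {x \<in> topspace A. f x \<in> U}"
      unfolding k_open_def
    proof (intro conjI allI impI)
      fix K :: "('k + real) topology" and t
      assume K: "compact_space K \<and> Hausdorff_space K \<and> continuous_map K A t"
      then have "continuous_map K X (f \<circ> t)"
        using f continuous_map_compose by blast
      then have "openin K {p \<in> topspace K. (f \<circ> t) p \<in> U}"
        using U K unfolding k_open_def by blast
      moreover have "{p \<in> topspace K. (f \<circ> t) p \<in> U} = {p \<in> topspace K. t p \<in> {x \<in> topspace A. f x \<in> U}}"
        using continuous_map_funspace[of K A t] K by auto
      ultimately show "openin K {p \<in> topspace K. t p \<in> {x \<in> topspace A. f x \<in> U}}"
        by simp
    qed auto
    then show "openin A {x \<in> topspace A. f x \<in> U}"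
      using assms by (simp add: cg_space_def)
  qed
qed

text \<open>The entry point for every map defined on a k-ified product or on a mapping space of the
  path category: after composition with \<open>t\<close> only families over a compact Hausdorff
  space remain.\<close>

lemma continuous_map_from_cg_space:
  fixes T :: "'k itself"
  assumes "cg_space T X"
    and f: "\<And>(K :: ('k + real) topology) t.
      \<lbrakk>compact_space K; Hausdorff_space K; continuous_map K X t\<rbrakk> \<Longrightarrow> continuous_map K Y (f \<circ> t)"
  shows "continuous_map X Y f"
  unfolding continuous_map_def
proof (intro conjI allI impI funcsetI)
  fix x assume x: "x \<in> topspace X"
  \<comment> \<open>A one-point test space shows that \<open>f\<close> maps points of
    \<open>X\<close> into \<open>Y\<close>. The summand \<open>real\<close> supplies its point for
    every choice of \<open>'k\<close>.\<close>
  let ?K = "discrete_topology {Inr 0} :: ('k + real) topology"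
  have "continuous_map ?K Y (f \<circ> (\<lambda>_. x))"
    using x by (intro f) (auto simp: compact_space_discrete_topology)
  then have "(f \<circ> (\<lambda>_. x)) \<in> topspace ?K \<rightarrow> topspace Y"
    by (rule continuous_map_funspace)
  then show "f x \<in> topspace Y"
    by simp
next
  fix U assume U: "openin Y U"
  have "k_open T X {x \<in> topspace X. f x \<in> U}"
    unfolding k_open_def
  proof (intro conjI allI impI)
    fix K :: "('k + real) topology" and t
    assume K: "compact_space K \<and> Hausdorff_space K \<and> continuous_map K X t"
    then have "openin K {p \<in> topspace K. (f \<circ> t) p \<in> U}"
      using f[of K t] U by (simp add: continuous_map_def)
    moreover have "{p \<in> topspace K. (f \<circ> t) p \<in> U} = {p \<in> topspace K. t p \<in> {x \<in> topspace X. f x \<in> U}}"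
      using continuous_map_funspace[of K X t] K by auto
    ultimately show "openin K {p \<in> topspace K. t p \<in> {x \<in> topspace X. f x \<in> U}}"
      by simp
  qed auto
  then show "openin X {x \<in> topspace X. f x \<in> U}"
    using assms(1) by (simp add: cg_space_def)
qed

lemma continuous_map_into_kprod:
  assumes "cg_space T A"
  shows "continuous_map A (kprod T X Y) f \<longleftrightarrow>
         continuous_map A X (\<lambda>x. fst (f x)) \<and> continuous_map A Y (\<lambda>x. snd (f x))"
  by (simp add: kprod_def continuous_map_into_kify assms continuous_map_pairwise comp_def)

lemma continuous_map_into_ksub:
  assumes "cg_space T A"
  shows "continuous_map A (ksub T X S) f \<longleftrightarrow> continuous_map A X f \<and> (\<forall>x\<in>topspace A. f x \<in> S)"
  by (auto simp: ksub_def continuous_map_into_kify assms continuous_map_in_subtopology)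

lemma topspace_kprod [simp]: "topspace (kprod T X Y) = topspace X \<times> topspace Y"
  by (simp add: kprod_def)

lemma topspace_ksub [simp]: "topspace (ksub T X S) = topspace X \<inter> S"
  by (simp add: ksub_def)

text \<open>
  These spaces need not live on the type \<^typ>\<open>'k + real\<close> of the test spaces of \<^const>\<open>k_open\<close>; it
  suffices that they embed into it as sets. As this type is infinite, they are closed under products,
  and maps from them into \<^const>\<open>kify\<close>, \<^const>\<open>kprod\<close> and \<^const>\<open>ksub\<close> can be checked for
  continuity as if there were no \<^const>\<open>kify\<close>.
\<close>

definition test_space :: "'k itself \<Rightarrow> 'a topology \<Rightarrow> bool" where
  "test_space T A \<longleftrightarrow> locally_compact_space A \<and> Hausdorff_space A \<and>
     (\<exists>e :: 'a \<Rightarrow> 'k + real. inj_on e (topspace A))"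

text \<open>A locally compact Hausdorff space is a k-space, so openness can be checked on compact
  subsets; each of these is copied along \<open>e\<close> into the type over which
  \<open>k_open\<close> quantifies.\<close>

lemma test_space_imp_cg_space:
  fixes T :: "'k itself"
  assumes "test_space T A"
  shows "cg_space T A"
  unfolding cg_space_def
proof (intro allI impI)
  fix U assume U: "k_open T A U"
  obtain e :: "'a \<Rightarrow> 'k + real" where e: "inj_on e (topspace A)"
    using assms by (auto simp: test_space_def)
  have "openin (subtopology A C) (C \<inter> U)" if C: "compactin A C" for C
  proof -
    define S where "S = subtopology A C"
    have S: "topspace S = C" "compact_space S" "Hausdorff_space S"
      using assms C compactin_subset_topspace[OF C]
      by (auto simp: S_def test_space_def compact_space_subtopology Hausdorff_space_subtopology)
    have inv: "inv_into C e (e c) = c" if "c \<in> C" for c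
      using that C compactin_subset_topspace[OF C] e by (meson inj_on_subset inv_into_f_f)
    \<comment> \<open>The copy of \<open>S\<close> on the set of codes, topologized so that
      \<open>e\<close> becomes a homeomorphism.\<close>
    define K where "K = pullback_topology (e ` C) (inv_into C e) S"
    have K: "topspace K = e ` C"
      using S inv by (auto simp: K_def topspace_pullback_topology)
    have homeo: "homeomorphic_maps S K e (inv_into C e)"
      unfolding homeomorphic_maps_def
    proof (intro conjI)
      have "continuous_map S S (inv_into C e \<circ> e)"
        using continuous_map_id by (rule continuous_map_eq) (simp add: S inv)
      then show "continuous_map S K e"
        unfolding K_def by (intro continuous_map_pullback') (auto simp: S)
      show "continuous_map K S (inv_into C e)"
        using continuous_map_pullback[of S S id "e ` C" "inv_into C e"] by (simp add: K_def)
    qed (auto simp: inv K S)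
    then have "compact_space K" "Hausdorff_space K"
      using S homeomorphic_compact_space homeomorphic_Hausdorff_space homeomorphic_space_def by blast+
    moreover have "continuous_map K A (inv_into C e)"
      using homeo by (auto simp: homeomorphic_maps_def S_def continuous_map_in_subtopology)
    ultimately have "openin K {p \<in> topspace K. inv_into C e p \<in> U}"
      using U by (simp add: k_open_def)
    then have "openin S {c \<in> topspace S. e c \<in> {p \<in> topspace K. inv_into C e p \<in> U}}"
      using homeo by (intro openin_continuous_map_preimage[of S K]) (auto simp: homeomorphic_maps_def)
    moreover have "{c \<in> topspace S. e c \<in> {p \<in> topspace K. inv_into C e p \<in> U}} = C \<inter> U"
      by (intro set_eqI) (simp add: K S inv cong: conj_cong)
    ultimately show ?thesis
      by (simp add: S_def)
  qed
  moreover have "k_space A"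
    using assms by (simp add: test_space_def locally_compact_imp_k_space)
  ultimately show "openin A U"
    using U by (simp add: k_space_open k_open_def)
qed

lemma test_space_compact:
  fixes T :: "'k itself" and K :: "('k + real) topology"
  assumes "compact_space K" "Hausdorff_space K"
  shows "test_space T K"
  unfolding test_space_def
proof (intro conjI exI)
  show "inj_on id (topspace K)"
    by simp
qed (use assms compact_imp_locally_compact_space in auto)

lemma test_space_prod_topology:
  fixes T :: "'k itself"
  assumes "test_space T A" "test_space T B"
  shows "test_space T (prod_topology A B)"
proof -
  obtain e e' where e: "inj_on (e :: _ \<Rightarrow> 'k + real) (topspace A)" "inj_on (e' :: _ \<Rightarrow> 'k + real) (topspace B)"
    using assms by (auto simp: test_space_def)
  have "infinite (UNIV :: ('k + real) set)"
    by (simp add: infinite_UNIV_char_0 finite_Plus_UNIV_iff)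
  from card_of_Times_same_infinite[OF this, folded card_of_ordIso]
  obtain p :: "('k + real) \<times> ('k + real) \<Rightarrow> 'k + real" where p: "inj p"
    by (auto simp: bij_betw_def)
  have "inj_on (\<lambda>x. p (e (fst x), e' (snd x))) (topspace (prod_topology A B))"
    using e by (auto simp: inj_on_def inj_eq[OF p])
  then show ?thesis
    using assms unfolding test_space_def
    by (auto simp: locally_compact_space_prod_topology Hausdorff_space_prod_topology)
qed

lemma test_space_real:
  "locally_compact_space A \<Longrightarrow> Hausdorff_space A \<Longrightarrow> test_space T (A :: real topology)"
  unfolding test_space_def by (auto intro!: exI[of _ Inr] simp: inj_on_def)

lemma test_space_half_line [simp]: "test_space T half_line"
  and locally_compact_half_line: "locally_compact_space half_line"
proof -
  show "locally_compact_space half_line"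
    by (intro locally_compact_space_closed_subset)
       (auto simp: locally_compact_space_euclidean regular_space_euclidean)
  then show "test_space T half_line"
    by (intro test_space_real) (auto simp: Hausdorff_space_subtopology)
qed

lemma test_space_interval [simp]: "test_space T (top_of_set {0..1::real})"
  by (intro test_space_real)
     (auto simp: Hausdorff_space_subtopology compact_space_subtopology intro!: compact_imp_locally_compact_space)

text \<open>Points of cubes are functions from \<open>nat\<close> to \<open>real\<close>, and they
  have to embed into \<open>'k + real\<close> even for a small \<open>'k\<close>. A real is replaced
  by a set of naturals, and a sequence of such sets is coded as one set by the pairing
  function.\<close>

lemma inj_nat_real: "\<exists>e :: (nat \<Rightarrow> real) \<Rightarrow> real. inj e"
proof -
  obtain d :: "real \<Rightarrow> nat set" where d: "bij d"
    using nat_sets_eqpoll_reals by (auto simp: eqpoll_def intro: bij_betw_inv_into)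
  define j where "j = (\<lambda>f. {prod_encode (n, m) |n m. m \<in> d (f n)})"
  have "inj j"
  proof (rule injI)
    fix f g assume "j f = j g"
    have "m \<in> d (f n) \<longleftrightarrow> prod_encode (n, m) \<in> j f" for f n m
      by (auto simp: j_def)
    then have "d (f n) = d (g n)" for n
      using \<open>j f = j g\<close> by blast
    then show "f = g"
      using d by (auto simp: bij_def inj_def)
  qed
  then have "inj (inv d \<circ> j)"
    using d by (intro inj_compose) (auto simp: bij_imp_bij_inv bij_is_inj)
  then show ?thesis
    by blast
qed

lemma test_space_cube [simp]: "test_space T (cube n)"
proof -
  obtain e :: "(nat \<Rightarrow> real) \<Rightarrow> real" where "inj e"
    using inj_nat_real by blast
  then have "inj (Inr \<circ> e)"
    by (intro inj_compose) auto
  moreover have "compact_space (cube n)" "Hausdorff_space (cube n)"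
    unfolding cube_def compact_space_product_topology Hausdorff_space_product_topology
    by (auto simp: compact_space_subtopology Hausdorff_space_subtopology)
  ultimately show ?thesis
    unfolding test_space_def by (meson compact_imp_locally_compact_space inj_on_subset subset_UNIV)
qed

section \<open>The exponential law and maps from test spaces into the Moore path space\<close>

lemma topspace_compact_open:
  "topspace (compact_open Y X) = {\<alpha> \<in> extensional (topspace Y). continuous_map Y X \<alpha>}"
proof
  \<comment> \<open>The subbasic set for the empty compact set and the empty open set is the whole
    function space.\<close>
  have "openin (compact_open Y X) {\<alpha> \<in> extensional (topspace Y). continuous_map Y X \<alpha> \<and> \<alpha> ` {} \<subseteq> {}}"
    unfolding compact_open_def by (intro topology_generated_by_Basis) blast
  then show "{\<alpha> \<in> extensional (topspace Y). continuous_map Y X \<alpha>} \<subseteq> topspace (compact_open Y X)"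
    using openin_subset by fastforce
qed (auto simp: compact_open_def topology_generated_by_topspace)

text \<open>By the tube lemma, if \<phi> maps \<open>{a}\<close> times the compact set
  \<open>C\<close> into \<open>U\<close>, it maps \<open>N\<close> times \<open>C\<close> into
  \<open>U\<close> for some neighbourhood \<open>N\<close> of \<open>a\<close>.\<close>

lemma continuous_map_compact_open_curry:
  assumes \<phi>: "continuous_map (prod_topology A Y) X (\<lambda>(a, u). \<phi> a u)"
    and ext: "\<And>a. a \<in> topspace A \<Longrightarrow> \<phi> a \<in> extensional (topspace Y)"
  shows "continuous_map A (compact_open Y X) \<phi>"
proof -
  have cont: "continuous_map Y X (\<phi> a)" if "a \<in> topspace A" for a
    using continuous_map_compose[of Y "prod_topology A Y" "\<lambda>u. (a, u)", OF _ \<phi>] that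
    by (simp add: comp_def continuous_map_paired)
  have "openin A (\<phi> -` {\<alpha> \<in> extensional (topspace Y). continuous_map Y X \<alpha> \<and> \<alpha> ` C \<subseteq> U} \<inter> topspace A)"
    if C: "compactin Y C" and U: "openin X U" for C U
  proof (subst openin_subopen, clarify)
    fix a assume a: "a \<in> topspace A" "\<phi> a ` C \<subseteq> U"
    let ?W = "{x \<in> topspace (prod_topology A Y). (\<lambda>(a, u). \<phi> a u) x \<in> U}"
    have "openin (prod_topology A Y) ?W"
      using \<phi> U by (rule openin_continuous_map_preimage)
    moreover have "{a} \<times> C \<subseteq> ?W"
      using a compactin_subset_topspace[OF C] by auto
    ultimately obtain N V where "openin A N" "a \<in> N" "C \<subseteq> V" "N \<times> V \<subseteq> ?W"
      using tube_lemma_right[of A Y ?W C a] C a(1) by blast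
    moreover have "\<phi> x v \<in> U" if "x \<in> N" "v \<in> C" for x v
    proof -
      have "(x, v) \<in> ?W"
        using \<open>C \<subseteq> V\<close> \<open>N \<times> V \<subseteq> ?W\<close> that by blast
      then show ?thesis
        by simp
    qed
    ultimately show "\<exists>N. openin A N \<and> a \<in> N \<and>
      N \<subseteq> \<phi> -` {\<alpha> \<in> extensional (topspace Y). continuous_map Y X \<alpha> \<and> \<alpha> ` C \<subseteq> U} \<inter> topspace A"
      using ext cont openin_subset[of A N] by (intro exI[of _ N]) auto
  qed
  moreover have "\<phi> ` topspace A \<subseteq> topspace (compact_open Y X)"
    using ext cont by (auto simp: topspace_compact_open)
  ultimately show ?thesis
    unfolding compact_open_def topology_generated_by_topspace
    by (intro continuous_on_generated_topo) auto
qed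

text \<open>Compact neighbourhoods make evaluation continuous: around \<open>u\<close> one finds a
  compact \<open>C\<close> that \<open>\<phi> a\<close> maps into \<open>U\<close>, and then the
  subbasic set of \<open>C\<close> and \<open>U\<close> controls all nearby functions at
  once.\<close>

lemma continuous_map_compact_open_uncurry:
  assumes Y: "neighbourhood_base_of (compactin Y) Y"
    and \<phi>: "continuous_map A (compact_open Y X) \<phi>"
  shows "continuous_map (prod_topology A Y) X (\<lambda>(a, u). \<phi> a u)"
proof -
  have mem: "\<phi> a \<in> extensional (topspace Y)" "continuous_map Y X (\<phi> a)" if "a \<in> topspace A" for a
    using continuous_map_funspace[OF \<phi>] that by (auto simp: topspace_compact_open)
  show ?thesis
    unfolding continuous_map_def
  proof (intro conjI allI impI)
    show "(\<lambda>(a, u). \<phi> a u) \<in> topspace (prod_topology A Y) \<rightarrow> topspace X"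
      using mem continuous_map_funspace by fastforce
    fix U assume U: "openin X U"
    show "openin (prod_topology A Y) {x \<in> topspace (prod_topology A Y). (\<lambda>(a, u). \<phi> a u) x \<in> U}"
      (is "openin _ ?W")
    proof (subst openin_subopen, intro ballI)
      fix x assume "x \<in> ?W"
      then obtain a u where x: "x = (a, u)" and au: "a \<in> topspace A" "u \<in> topspace Y" "\<phi> a u \<in> U"
        by auto
      have "openin Y {u \<in> topspace Y. \<phi> a u \<in> U}"
        using mem au U by (intro openin_continuous_map_preimage[of _ X])
      moreover have "u \<in> {u \<in> topspace Y. \<phi> a u \<in> U}"
        using au by simp
      ultimately obtain V C where VC: "openin Y V" "compactin Y C" "u \<in> V" "V \<subseteq> C" "C \<subseteq> {u \<in> topspace Y. \<phi> a u \<in> U}"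
        using neighbourhood_base_of[THEN iffD1, OF Y, rule_format, OF conjI] by (metis (lifting))
      let ?S = "{\<alpha> \<in> extensional (topspace Y). continuous_map Y X \<alpha> \<and> \<alpha> ` C \<subseteq> U}"
      have "openin (compact_open Y X) ?S"
        unfolding compact_open_def using VC U by (intro topology_generated_by_Basis) blast
      then have "openin A {a \<in> topspace A. \<phi> a \<in> ?S}"
        using \<phi> by (rule openin_continuous_map_preimage[rotated])
      then have "openin (prod_topology A Y) ({a \<in> topspace A. \<phi> a \<in> ?S} \<times> V)"
        using VC by (simp add: openin_prod_Times_iff)
      moreover have "(a, u) \<in> {a \<in> topspace A. \<phi> a \<in> ?S} \<times> V"
        using mem au VC by auto
      moreover have "{a \<in> topspace A. \<phi> a \<in> ?S} \<times> V \<subseteq> ?W"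
        using openin_subset[OF VC(1)] by (auto simp: image_subset_iff dest: subsetD[OF VC(4)])
      ultimately show "\<exists>N. openin (prod_topology A Y) N \<and> x \<in> N \<and> N \<subseteq> ?W"
        unfolding x by blast
    qed
  qed
qed

text \<open>Each \<open>kify\<close> in the definition disappears because \<open>A\<close> is
  compactly generated, and local compactness of the half line gives the exponential law with the
  ordinary product. All continuity statements about Moore paths rest on this equivalence.\<close>

lemma continuous_map_into_moore_space:
  assumes A: "test_space T A"
  shows "continuous_map A (moore_space T X) \<phi> \<longleftrightarrow>
    continuous_map A half_line (\<lambda>a. snd (\<phi> a)) \<and>
    continuous_map (prod_topology A half_line) X (\<lambda>(a, u). fst (\<phi> a) u) \<and>
    (\<forall>a\<in>topspace A. fst (\<phi> a) \<in> extensional {0..} \<and> (\<forall>s\<ge>snd (\<phi> a). fst (\<phi> a) s = fst (\<phi> a) (snd (\<phi> a))))"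
    (is "?L \<longleftrightarrow> ?R")
proof -
  have cg: "cg_space T A"
    using A by (rule test_space_imp_cg_space)
  have nb: "neighbourhood_base_of (compactin half_line) half_line"
    by (simp add: locally_compact_half_line locally_compact_imp_neighbourhood_base
        locally_compact_Hausdorff_imp_regular_space Hausdorff_space_subtopology)
  have "?L \<longleftrightarrow> continuous_map A (compact_open half_line X) (\<lambda>a. fst (\<phi> a)) \<and>
      continuous_map A half_line (\<lambda>a. snd (\<phi> a)) \<and>
      (\<forall>a\<in>topspace A. \<forall>s\<ge>snd (\<phi> a). fst (\<phi> a) s = fst (\<phi> a) (snd (\<phi> a)))"
    by (simp add: moore_space_def continuous_map_into_ksub continuous_map_into_kprod cg
        continuous_map_into_kify case_prod_beta conj_assoc)
  moreover have "continuous_map A (compact_open half_line X) (\<lambda>a. fst (\<phi> a)) \<longleftrightarrow>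
      continuous_map (prod_topology A half_line) X (\<lambda>(a, u). fst (\<phi> a) u) \<and>
      (\<forall>a\<in>topspace A. fst (\<phi> a) \<in> extensional {0..})"
  proof (intro iffI conjI)
    assume c: "continuous_map A (compact_open half_line X) (\<lambda>a. fst (\<phi> a))"
    show "continuous_map (prod_topology A half_line) X (\<lambda>(a, u). fst (\<phi> a) u)"
      using nb c by (rule continuous_map_compact_open_uncurry)
    show "\<forall>a\<in>topspace A. fst (\<phi> a) \<in> extensional {0..}"
      using continuous_map_funspace[OF c] by (auto simp: topspace_compact_open)
  next
    assume *: "continuous_map (prod_topology A half_line) X (\<lambda>(a, u). fst (\<phi> a) u) \<and>
      (\<forall>a\<in>topspace A. fst (\<phi> a) \<in> extensional {0..})"
    show "continuous_map A (compact_open half_line X) (\<lambda>a. fst (\<phi> a))"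
      by (rule continuous_map_compact_open_curry) (use * in simp_all)
  qed
  ultimately show ?thesis
    by (simp add: ball_conj_distrib conj_ac)
qed

lemma topspace_moore_space:
  "topspace (moore_space T X) = {(\<alpha>, r). 0 \<le> r \<and> \<alpha> \<in> extensional {0..} \<and>
     continuous_map half_line X \<alpha> \<and> (\<forall>s\<ge>r. \<alpha> s = \<alpha> r)}"
  by (rule set_eqI)
     (simp only: moore_space_def topspace_compact_open topspace_ksub topspace_kprod topspace_kify
       Int_iff mem_Times_iff mem_Collect_eq case_prod_beta topspace_euclidean_subtopology atLeast_iff conj_ac)

lemma continuous_map_eval:
  assumes "continuous_map (prod_topology A Y) X (\<lambda>(a, u). \<phi> a u)"
    and "continuous_map B A \<sigma>" "continuous_map B Y \<theta>"
  shows "continuous_map B X (\<lambda>b. \<phi> (\<sigma> b) (\<theta> b))"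
  using continuous_map_compose[of B "prod_topology A Y" "\<lambda>b. (\<sigma> b, \<theta> b)", OF _ assms(1)] assms(2,3)
  by (simp add: comp_def continuous_map_paired)

section \<open>Deformation retracts\<close>

lemma ball_cube_boundary_cong:
  "(\<And>q. q \<in> topspace (cube n) \<Longrightarrow> h q = k q) \<Longrightarrow>
    (\<forall>q\<in>cube_boundary n. h q = x) \<longleftrightarrow> (\<forall>q\<in>cube_boundary n. k q = x)"
  by (intro ball_cong) (auto simp: cube_boundary_def)

lemma equiv_spheroid_htpy: "equiv (spheroids n X x) (spheroid_htpy n X x)"
proof (rule equivI)
  show "refl_on (spheroids n X x) (spheroid_htpy n X x)"
    by (auto simp: refl_on_def spheroid_htpy_def spheroids_def)
  show "sym (spheroid_htpy n X x)"
    by (auto simp: sym_def spheroid_htpy_def homotopic_with_sym)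
  show "trans (spheroid_htpy n X x)"
    unfolding trans_def spheroid_htpy_def using homotopic_with_trans by fast
qed (auto simp: spheroid_htpy_def)

lemma spheroids_compose:
  "continuous_map X Y f \<Longrightarrow> s \<in> spheroids n X x \<Longrightarrow> f \<circ> s \<in> spheroids n Y (f x)"
  by (auto simp: spheroids_def intro: continuous_map_compose)

lemma spheroid_htpy_compose:
  assumes "continuous_map X Y f" "(s, s') \<in> spheroid_htpy n X x"
  shows "(f \<circ> s, f \<circ> s') \<in> spheroid_htpy n Y (f x)"
  using assms unfolding spheroid_htpy_def
  by (auto simp: spheroids_compose elim!: homotopic_with_compose_continuous_map_left)

text \<open>The induced map is defined as a union over all representatives; since composition with
  \<open>f\<close> respects homotopy, every representative contributes the same class.\<close>

lemma homotopy_group_map_class: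
  assumes f: "continuous_map X Y f" and s: "s \<in> spheroids n X x"
  shows "homotopy_group_map n Y f x (spheroid_htpy n X x `` {s}) = spheroid_htpy n Y (f x) `` {f \<circ> s}"
proof -
  have "spheroid_htpy n Y (f x) `` {f \<circ> s'} = spheroid_htpy n Y (f x) `` {f \<circ> s}"
    if "(s, s') \<in> spheroid_htpy n X x" for s'
    using spheroid_htpy_compose[OF f that] equiv_class_eq[OF equiv_spheroid_htpy] by metis
  moreover have "(s, s) \<in> spheroid_htpy n X x"
    using equiv_class_self[OF equiv_spheroid_htpy s] by simp
  ultimately show ?thesis
    unfolding homotopy_group_map_def by blast
qed

lemma path_components_map_class:
  assumes f: "continuous_map X Y f" and x: "x \<in> topspace X"
  shows "path_components_map Y f (path_component_of_set X x) = path_component_of_set Y (f x)"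
proof -
  have "path_component_of_set Y (f x') = path_component_of_set Y (f x)" if "path_component_of X x x'" for x'
    using path_component_of_continuous_image[OF f that] by (metis path_component_of_equiv)
  moreover have "path_component_of X x x"
    using x by (simp add: path_component_of_refl)
  ultimately show ?thesis
    unfolding path_components_map_def by blast
qed

text \<open>
  The homotopy \<open>H\<close> is only required to be continuous along maps from cubes: this avoids the product of
  \<open>Y\<close> with the interval, which is not a test space.
\<close>

lemma weak_homotopy_equivalence_deformation_retract:
  assumes i: "continuous_map X Y i" and p: "continuous_map Y X p"
    and pi: "\<And>x. x \<in> topspace X \<Longrightarrow> p (i x) = x"
    and H: "\<And>n s. continuous_map (cube n) Y s \<Longrightarrow>
      continuous_map (prod_topology (top_of_set {0..1}) (cube n)) Y (\<lambda>(t :: real, q). H t (s q))"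
    and H0: "\<And>y. y \<in> topspace Y \<Longrightarrow> H 0 y = y"
    and H1: "\<And>y. y \<in> topspace Y \<Longrightarrow> H 1 y = i (p y)"
    and Hi: "\<And>x t. x \<in> topspace X \<Longrightarrow> 0 \<le> t \<Longrightarrow> t \<le> 1 \<Longrightarrow> H t (i x) = i x"
  shows "weak_homotopy_equivalence X Y i"
  unfolding weak_homotopy_equivalence_def
proof (intro conjI allI impI ballI)
  have path: "path_component_of Y y (i (p y))" if y: "y \<in> topspace Y" for y
  proof -
    \<comment> \<open>The cube of dimension 0 is a point, so \<open>H\<close> along a constant map
      is a path from \<open>y\<close> to \<open>i (p y)\<close>.\<close>
    have "continuous_map (prod_topology (top_of_set {0..1}) (cube 0)) Y (\<lambda>(t, q). H t y)"
      using H[of 0 "\<lambda>_. y"] y by simp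
    \<comment> \<open>The constant function \<open>undefined\<close> is the only point of
      \<open>cube 0\<close>, being the only extensional function on the empty index set.\<close>
    moreover have "continuous_map (top_of_set {0..1}) (prod_topology (top_of_set {0..1}) (cube 0)) (\<lambda>t::real. (t, \<lambda>_. undefined))"
      by (auto simp: continuous_map_paired cube_def)
    ultimately have "continuous_map (top_of_set {0..1}) Y ((\<lambda>(t, q). H t y) \<circ> (\<lambda>t. (t, (\<lambda>_. undefined) :: nat \<Rightarrow> real)))"
      by (rule continuous_map_compose[rotated])
    then have "pathin Y (\<lambda>t. H t y)"
      by (simp add: pathin_def comp_def)
    then show ?thesis
      unfolding path_component_of_def using H0[OF y] H1[OF y] by blast
  qed
  show "bij_betw (path_components_map Y i) (path_components_of X) (path_components_of Y)"
  proof (rule bij_betw_imageI)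
    show "inj_on (path_components_map Y i) (path_components_of X)"
    proof (rule inj_onI)
      fix A B
      assume "A \<in> path_components_of X" "B \<in> path_components_of X"
        and eq: "path_components_map Y i A = path_components_map Y i B"
      then obtain a b where ab: "a \<in> topspace X" "A = path_component_of_set X a"
          "b \<in> topspace X" "B = path_component_of_set X b"
        by (auto simp: path_components_of_def)
      then have "path_component_of_set Y (i a) = path_component_of_set Y (i b)"
        using eq path_components_map_class[OF i] by simp
      moreover have "path_component_of Y (i b) (i b)"
        using ab continuous_map_funspace[OF i] by (auto simp: path_component_of_refl)
      ultimately have "path_component_of Y (i a) (i b)"
        by blast
      then have "path_component_of X a b"
        using path_component_of_continuous_image[OF p] ab pi by metis
      then show "A = B"
        using ab by (simp add: path_component_of_equiv)
    qed
    show "path_components_map Y i ` path_components_of X = path_components_of Y"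
    proof (intro equalityI subsetI)
      fix B assume "B \<in> path_components_map Y i ` path_components_of X"
      then show "B \<in> path_components_of Y"
        using continuous_map_funspace[OF i] path_components_map_class[OF i]
        by (auto simp: path_components_of_def)
    next
      fix B assume "B \<in> path_components_of Y"
      then obtain y where y: "y \<in> topspace Y" "B = path_component_of_set Y y"
        by (auto simp: path_components_of_def)
      have "B = path_component_of_set Y (i (p y))"
        using path[OF y(1)] y by (simp add: path_component_of_equiv)
      moreover have "p y \<in> topspace X"
        using continuous_map_funspace[OF p] y by auto
      ultimately show "B \<in> path_components_map Y i ` path_components_of X"
        using path_components_map_class[OF i] by (auto simp: path_components_of_def)
    qed
  qed
  fix n x assume x: "x \<in> topspace X"
  show "bij_betw (homotopy_group_map n Y i x) (homotopy_group n X x) (homotopy_group n Y (i x))"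
  proof (rule bij_betw_imageI)
    show "inj_on (homotopy_group_map n Y i x) (homotopy_group n X x)"
    proof (rule inj_onI)
      fix A B
      assume "A \<in> homotopy_group n X x" "B \<in> homotopy_group n X x"
        and eq: "homotopy_group_map n Y i x A = homotopy_group_map n Y i x B"
      then obtain s s' where s: "s \<in> spheroids n X x" "A = spheroid_htpy n X x `` {s}"
          "s' \<in> spheroids n X x" "B = spheroid_htpy n X x `` {s'}"
        by (auto simp: homotopy_group_def quotient_def)
      then have "(i \<circ> s, i \<circ> s') \<in> spheroid_htpy n Y (i x)"
        using eq homotopy_group_map_class[OF i] spheroids_compose[OF i] eq_equiv_class[OF _ equiv_spheroid_htpy]
        by metis
      then have "(p \<circ> (i \<circ> s), p \<circ> (i \<circ> s')) \<in> spheroid_htpy n X (p (i x))"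
        by (rule spheroid_htpy_compose[OF p])
      then have "homotopic_with (\<lambda>h. \<forall>q\<in>cube_boundary n. h q = x) (cube n) X (p \<circ> (i \<circ> s)) (p \<circ> (i \<circ> s'))"
        using x pi by (simp add: spheroid_htpy_def)
      moreover have "s q = (p \<circ> (i \<circ> s)) q" "s' q = (p \<circ> (i \<circ> s')) q" if "q \<in> topspace (cube n)" for q
      proof -
        have "s \<in> topspace (cube n) \<rightarrow> topspace X" "s' \<in> topspace (cube n) \<rightarrow> topspace X"
          using s by (auto simp: spheroids_def intro!: continuous_map_funspace)
        then show "s q = (p \<circ> (i \<circ> s)) q" "s' q = (p \<circ> (i \<circ> s')) q"
          using that pi by (simp_all add: Pi_iff)
      qed
      ultimately have "homotopic_with (\<lambda>h. \<forall>q\<in>cube_boundary n. h q = x) (cube n) X s s'"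
        by (rule homotopic_with_eq) (assumption | rule ball_cube_boundary_cong)+
      then have "(s, s') \<in> spheroid_htpy n X x"
        using s by (simp add: spheroid_htpy_def)
      from equiv_class_eq[OF equiv_spheroid_htpy this] show "A = B"
        using s by simp
    qed
    show "homotopy_group_map n Y i x ` homotopy_group n X x = homotopy_group n Y (i x)"
    proof (intro equalityI subsetI)
      fix B assume "B \<in> homotopy_group_map n Y i x ` homotopy_group n X x"
      then show "B \<in> homotopy_group n Y (i x)"
        using homotopy_group_map_class[OF i] spheroids_compose[OF i]
        by (fastforce simp: homotopy_group_def quotient_def)
    next
      fix B assume "B \<in> homotopy_group n Y (i x)"
      then obtain s where s: "s \<in> spheroids n Y (i x)" "B = spheroid_htpy n Y (i x) `` {s}"
        by (auto simp: homotopy_group_def quotient_def)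
      have ps: "p \<circ> s \<in> spheroids n X x"
        using spheroids_compose[OF p s(1)] x pi by simp
      have sc: "continuous_map (cube n) Y s" and sb: "\<And>q. q \<in> cube_boundary n \<Longrightarrow> s q = i x"
        using s by (auto simp: spheroids_def)
      \<comment> \<open>Here the retraction has to be a strong one: the boundary is mapped to
        \<open>i x\<close>, which \<open>H\<close> keeps fixed, so the homotopy from
        \<open>s\<close> to \<open>i \<circ> (p \<circ> s)\<close> is based.\<close>
      have "homotopic_with (\<lambda>h. \<forall>q\<in>cube_boundary n. h q = i x) (cube n) Y s (i \<circ> (p \<circ> s))"
      proof (subst homotopic_with)
        show "\<exists>h. continuous_map (prod_topology (top_of_set {0..1::real}) (cube n)) Y h \<and>
            (\<forall>q\<in>topspace (cube n). h (0, q) = s q) \<and>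
            (\<forall>q\<in>topspace (cube n). h (1, q) = (i \<circ> (p \<circ> s)) q) \<and>
            (\<forall>t\<in>{0..1}. \<forall>q\<in>cube_boundary n. h (t, q) = i x)"
        proof (rule exI[of _ "\<lambda>(t, q). H t (s q)"], intro conjI ballI)
          show "continuous_map (prod_topology (top_of_set {0..1::real}) (cube n)) Y (\<lambda>(t, q). H t (s q))"
            using sc by (rule H)
        next
          fix q assume "q \<in> topspace (cube n)"
          then have "s q \<in> topspace Y"
            using continuous_map_funspace[OF sc] by blast
          then show "(\<lambda>(t, q). H t (s q)) (0, q) = s q" "(\<lambda>(t, q). H t (s q)) (1, q) = (i \<circ> (p \<circ> s)) q"
            using H0 H1 by auto
        qed (use sb Hi x in auto)
      qed (rule ball_cube_boundary_cong)
      then have "(s, i \<circ> (p \<circ> s)) \<in> spheroid_htpy n Y (i x)"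
        using s spheroids_compose[OF i ps] by (simp add: spheroid_htpy_def)
      from equiv_class_eq[OF equiv_spheroid_htpy this]
      have "B = homotopy_group_map n Y i x (spheroid_htpy n X x `` {p \<circ> s})"
        using s homotopy_group_map_class[OF i ps] by simp
      then show "B \<in> homotopy_group_map n Y i x ` homotopy_group n X x"
        using ps by (auto simp: homotopy_group_def quotient_def)
    qed
  qed
qed (rule i)

lemma path_component_of_kprod:
  assumes "path_component_of (kprod T X Y) (a, b) (c, d)"
  shows "path_component_of X a c" "path_component_of Y b d"
proof -
  obtain p where p: "pathin (kprod T X Y) p" "p 0 = (a, b)" "p 1 = (c, d)"
    using assms by (auto simp: path_component_of_def)
  then have "pathin X (\<lambda>t. fst (p t))" "pathin Y (\<lambda>t. snd (p t))"
    by (auto simp: pathin_def continuous_map_into_kprod test_space_imp_cg_space)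
  with p show "path_component_of X a c" "path_component_of Y b d"
    unfolding path_component_of_def by (metis fst_conv, metis snd_conv)
qed

section \<open>Weak equivalences in a topological category\<close>

locale top_category =
  fixes T :: "'k itself" and C :: "('o, 'm) tcat"
  assumes topological_category: "topological_category T C"
begin

abbreviation "Hom x y \<equiv> topspace (Map C x y)"
abbreviation "htpy x y \<equiv> path_component_of (Map C x y)"

lemma cg_space_Map: "x \<in> Ob C \<Longrightarrow> y \<in> Ob C \<Longrightarrow> cg_space T (Map C x y)"
  and Id_in_Hom [simp, intro]: "x \<in> Ob C \<Longrightarrow> Id C x \<in> Hom x x"
  and Comp_Id_right [simp]: "x \<in> Ob C \<Longrightarrow> y \<in> Ob C \<Longrightarrow> f \<in> Hom x y \<Longrightarrow> Comp C x x y f (Id C x) = f"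
  and Comp_Id_left [simp]: "x \<in> Ob C \<Longrightarrow> y \<in> Ob C \<Longrightarrow> f \<in> Hom x y \<Longrightarrow> Comp C x y y (Id C y) f = f"
  using topological_category unfolding topological_category_def by auto

lemma Comp_assoc:
  "\<lbrakk>w \<in> Ob C; x \<in> Ob C; y \<in> Ob C; z \<in> Ob C; f \<in> Hom w x; g \<in> Hom x y; h \<in> Hom y z\<rbrakk> \<Longrightarrow>
    Comp C w x z (Comp C x y z h g) f = Comp C w y z h (Comp C w x y g f)"
  using topological_category unfolding topological_category_def by blast

lemma continuous_map_Comp_kprod:
  "\<lbrakk>x \<in> Ob C; y \<in> Ob C; z \<in> Ob C\<rbrakk> \<Longrightarrow>
    continuous_map (kprod T (Map C y z) (Map C x y)) (Map C x z) (\<lambda>(g, f). Comp C x y z g f)"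
  using topological_category unfolding topological_category_def by blast

text \<open>Composition is assumed continuous on \<open>kprod\<close>; a pair of continuous families
  over a test space is automatically continuous into it.\<close>

lemma continuous_map_Comp:
  assumes "x \<in> Ob C" "y \<in> Ob C" "z \<in> Ob C" "test_space T A"
    and "continuous_map A (Map C y z) g" "continuous_map A (Map C x y) f"
  shows "continuous_map A (Map C x z) (\<lambda>a. Comp C x y z (g a) (f a))"
proof -
  have "continuous_map A (kprod T (Map C y z) (Map C x y)) (\<lambda>a. (g a, f a))"
    using assms by (simp add: continuous_map_into_kprod test_space_imp_cg_space)
  from continuous_map_compose[OF this continuous_map_Comp_kprod] show ?thesis
    using assms by (simp add: comp_def)
qed

lemma Comp_in_Hom [simp, intro]:
  "\<lbrakk>x \<in> Ob C; y \<in> Ob C; z \<in> Ob C; g \<in> Hom y z; f \<in> Hom x y\<rbrakk> \<Longrightarrow> Comp C x y z g f \<in> Hom x z"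
  using continuous_map_funspace[OF continuous_map_Comp_kprod[of x y z]] by (fastforce simp: Pi_iff)

lemma htpy_Comp:
  assumes "x \<in> Ob C" "y \<in> Ob C" "z \<in> Ob C" "htpy y z g g'" "htpy x y f f'"
  shows "htpy x z (Comp C x y z g f) (Comp C x y z g' f')"
proof -
  obtain G F where "pathin (Map C y z) G" "G 0 = g" "G 1 = g'" "pathin (Map C x y) F" "F 0 = f" "F 1 = f'"
    using assms by (auto simp: path_component_of_def)
  then show ?thesis
    using continuous_map_Comp[of x y z "top_of_set {0..1}" G F] assms
    by (auto simp: path_component_of_def pathin_def intro!: exI[of _ "\<lambda>t. Comp C x y z (G t) (F t)"])
qed

lemma htpy_Comp_left:
  "\<lbrakk>x \<in> Ob C; y \<in> Ob C; z \<in> Ob C; htpy y z g g'; f \<in> Hom x y\<rbrakk> \<Longrightarrow>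
    htpy x z (Comp C x y z g f) (Comp C x y z g' f)"
  by (simp add: htpy_Comp path_component_of_refl)

lemma htpy_Comp_right:
  "\<lbrakk>x \<in> Ob C; y \<in> Ob C; z \<in> Ob C; htpy x y f f'; g \<in> Hom y z\<rbrakk> \<Longrightarrow>
    htpy x z (Comp C x y z g f) (Comp C x y z g f')"
  by (simp add: htpy_Comp path_component_of_refl)

text \<open>An isomorphism of \<open>pi0_cat C\<close> on the level of representatives. By
  \<open>weak_equivalence_in_iff\<close>, weak equivalences can be handled by calculating with
  morphisms up to \<open>htpy\<close> instead of with classes.\<close>

definition htpy_inverse :: "'o \<Rightarrow> 'o \<Rightarrow> 'm \<Rightarrow> 'm \<Rightarrow> bool" where
  "htpy_inverse x y a b \<longleftrightarrow> x \<in> Ob C \<and> y \<in> Ob C \<and> a \<in> Hom x y \<and> b \<in> Hom y x \<and>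
     htpy x x (Comp C x y x b a) (Id C x) \<and> htpy y y (Comp C y x y a b) (Id C y)"

lemma htpy_inverse_sym: "htpy_inverse x y a b \<Longrightarrow> htpy_inverse y x b a"
  by (auto simp: htpy_inverse_def)

lemma pi0_compose:
  assumes "x \<in> Ob C" "y \<in> Ob C" "z \<in> Ob C" "g \<in> Hom y z" "f \<in> Hom x y"
  shows "compose (pi0_cat C) x y z (path_component_of_set (Map C y z) g) (path_component_of_set (Map C x y) f) =
         path_component_of_set (Map C x z) (Comp C x y z g f)"
proof -
  have "path_component_of_set (Map C x z) (Comp C x y z g' f') = path_component_of_set (Map C x z) (Comp C x y z g f)"
    if "htpy y z g g'" "htpy x y f f'" for g' f'
    using htpy_Comp[OF assms(1-3) that] by (simp add: path_component_of_equiv)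
  moreover have "htpy y z g g" "htpy x y f f"
    using assms by (auto simp: path_component_of_refl)
  ultimately have "(\<Union>g'\<in>path_component_of_set (Map C y z) g. \<Union>f'\<in>path_component_of_set (Map C x y) f.
      path_component_of_set (Map C x z) (Comp C x y z g' f')) = path_component_of_set (Map C x z) (Comp C x y z g f)"
    by blast
  then show ?thesis
    by (simp add: pi0_cat_def)
qed

lemma weak_equivalence_in_iff: "weak_equivalence_in C x y a \<longleftrightarrow> (\<exists>b. htpy_inverse x y a b)"
proof (cases "x \<in> Ob C \<and> y \<in> Ob C \<and> a \<in> Hom x y")
  case True
  then have xy: "x \<in> Ob C" "y \<in> Ob C" "a \<in> Hom x y"
    by auto
  have eq: "path_component_of_set (Map C z z) f = path_component_of_set (Map C z z) (Id C z) \<longleftrightarrow> htpy z z f (Id C z)"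
    if "z \<in> Ob C" "f \<in> Hom z z" for z f
    using that by (auto simp: path_component_of_equiv[of _ f] dest: Collect_inj)
  have "weak_equivalence_in C x y a \<longleftrightarrow>
    (\<exists>v\<in>path_components_of (Map C y x).
       compose (pi0_cat C) x y x v (path_component_of_set (Map C x y) a) = path_component_of_set (Map C x x) (Id C x) \<and>
       compose (pi0_cat C) y x y (path_component_of_set (Map C x y) a) v = path_component_of_set (Map C y y) (Id C y))"
    using xy unfolding weak_equivalence_in_def is_iso_def
    by (simp add: pi0_cat_def path_components_of_def)
  also have "\<dots> \<longleftrightarrow> (\<exists>b\<in>Hom y x. htpy x x (Comp C x y x b a) (Id C x) \<and> htpy y y (Comp C y x y a b) (Id C y))"
    unfolding path_components_of_def using xy by (simp add: pi0_compose eq)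
  finally show ?thesis
    using xy by (auto simp: htpy_inverse_def)
qed (auto simp: weak_equivalence_in_def htpy_inverse_def)

lemma weak_equivalence_in_Id: "x \<in> Ob C \<Longrightarrow> weak_equivalence_in C x x (Id C x)"
  unfolding weak_equivalence_in_iff htpy_inverse_def by (auto simp: path_component_of_refl)

lemma weak_equivalence_in_htpy:
  "weak_equivalence_in C x y a \<Longrightarrow> htpy x y a a' \<Longrightarrow> weak_equivalence_in C x y a'"
  unfolding weak_equivalence_in_def by (simp add: path_component_of_equiv)

text \<open>The two middle factors in (c b') (b a) cancel after reassociation. Both composites of a
  product of weak equivalences with the product of the inverses have this shape.\<close>

lemma htpy_cancel:
  assumes ob: "x \<in> Ob C" "y \<in> Ob C" "z \<in> Ob C" "w \<in> Ob C"
    and b: "b \<in> Hom y z" "b' \<in> Hom z y" "htpy y y (Comp C y z y b' b) (Id C y)"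
    and a: "a \<in> Hom x y" and c: "c \<in> Hom y w"
  shows "htpy x w (Comp C x z w (Comp C z y w c b') (Comp C x y z b a)) (Comp C x y w c a)"
proof -
  have "Comp C x z w (Comp C z y w c b') (Comp C x y z b a) =
      Comp C x y w c (Comp C x y y (Comp C y z y b' b) a)"
    using ob b a c by (simp add: Comp_assoc)
  moreover have "htpy x w \<dots> (Comp C x y w c (Comp C x y y (Id C y) a))"
    using ob b a c by (intro htpy_Comp_right htpy_Comp_left) auto
  ultimately show ?thesis
    using ob a by simp
qed

lemma weak_equivalence_in_Comp:
  assumes "weak_equivalence_in C x y a" "weak_equivalence_in C y z b"
  shows "weak_equivalence_in C x z (Comp C x y z b a)"
proof -
  obtain a' b' where a: "htpy_inverse x y a a'" and b: "htpy_inverse y z b b'"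
    using assms by (auto simp: weak_equivalence_in_iff)
  have "htpy x x (Comp C x z x (Comp C z y x a' b') (Comp C x y z b a)) (Comp C x y x a' a)"
    using a b by (intro htpy_cancel) (auto simp: htpy_inverse_def)
  moreover have "htpy z z (Comp C z x z (Comp C x y z b a) (Comp C z y x a' b')) (Comp C z y z b b')"
    using a b by (intro htpy_cancel) (auto simp: htpy_inverse_def)
  ultimately have "htpy_inverse x z (Comp C x y z b a) (Comp C z y x a' b')"
    using a b by (auto simp: htpy_inverse_def intro: path_component_of_trans)
  then show ?thesis
    by (auto simp: weak_equivalence_in_iff)
qed

text \<open>If \<open>w\<close> inverts v u and \<open>w'\<close> inverts u v, then l = w v is a
  left and r = v w' a right inverse of \<open>u\<close> up to homotopy. They agree, since r is
  homotopic to (l u) r = l (u r), which is homotopic to l.\<close>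

lemma weak_equivalence_in_two_sided:
  assumes u: "u \<in> Hom x y" and v: "v \<in> Hom y x"
    and vu: "weak_equivalence_in C x x (Comp C x y x v u)" and uv: "weak_equivalence_in C y y (Comp C y x y u v)"
  shows "weak_equivalence_in C x y u"
proof -
  obtain w w' where w: "htpy_inverse x x (Comp C x y x v u) w" and w': "htpy_inverse y y (Comp C y x y u v) w'"
    using vu uv by (auto simp: weak_equivalence_in_iff)
  then have ob: "x \<in> Ob C" "y \<in> Ob C" and W: "w \<in> Hom x x" "w' \<in> Hom y y"
    by (auto simp: htpy_inverse_def)
  define l r where "l = Comp C y x x w v" and "r = Comp C y y x v w'"
  have lr: "l \<in> Hom y x" "r \<in> Hom y x"
    using ob W v by (auto simp: l_def r_def)
  have lu: "htpy x x (Comp C x y x l u) (Id C x)"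
    using w ob W u v by (simp add: l_def Comp_assoc htpy_inverse_def)
  have ur: "htpy y y (Comp C y x y u r) (Id C y)"
    using w' ob W u v by (simp add: r_def Comp_assoc[symmetric] htpy_inverse_def)
  have "htpy y x (Comp C y x x (Comp C x y x l u) r) (Comp C y x x (Id C x) r)"
    using ob lu lr by (intro htpy_Comp_left)
  moreover have "htpy y x (Comp C y y x l (Comp C y x y u r)) (Comp C y y x l (Id C y))"
    using ob ur lr by (intro htpy_Comp_right)
  ultimately have "htpy y x r l"
    using ob lr u by (auto simp: Comp_assoc intro: path_component_of_trans path_component_of_sym)
  then have "htpy x x (Comp C x y x r u) (Id C x)"
    using ob u lu by (blast intro: path_component_of_trans htpy_Comp_left)
  then show ?thesis
    using ob u lr ur by (auto simp: weak_equivalence_in_iff htpy_inverse_def)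
qed

end

section \<open>Products of topological categories\<close>

lemma topological_category_prod_cat:
  fixes T :: "'k itself"
  assumes "topological_category T C" "topological_category T D"
  shows "topological_category T (prod_cat T C D)"
proof -
  interpret C: top_category T C by unfold_locales fact
  interpret D: top_category T D by unfold_locales fact
  show ?thesis
    unfolding topological_category_def
  proof (intro conjI ballI)
    fix x y z
    assume "x \<in> Ob (prod_cat T C D)" "y \<in> Ob (prod_cat T C D)" "z \<in> Ob (prod_cat T C D)"
    then obtain x1 x2 y1 y2 z1 z2 where eq: "x = (x1, x2)" "y = (y1, y2)" "z = (z1, z2)"
      and ob: "x1 \<in> Ob C" "y1 \<in> Ob C" "z1 \<in> Ob C" "x2 \<in> Ob D" "y2 \<in> Ob D" "z2 \<in> Ob D"
      by (cases x, cases y, cases z) (auto simp: prod_cat_def)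
    show "continuous_map (kprod T (Map (prod_cat T C D) y z) (Map (prod_cat T C D) x y))
        (Map (prod_cat T C D) x z) (\<lambda>(g, f). Comp (prod_cat T C D) x y z g f)"
    \<comment> \<open>Composition in the product permutes the four factors of a product of products.
      Over a test space the factors separate, so no homeomorphism between k-ified products has to be
      constructed.\<close>
    proof (rule continuous_map_from_cg_space)
      show "cg_space T (kprod T (Map (prod_cat T C D) y z) (Map (prod_cat T C D) x y))"
        unfolding kprod_def by (rule cg_space_kify)
      fix K :: "('k + real) topology" and t
      assume K: "compact_space K" "Hausdorff_space K"
        and t: "continuous_map K (kprod T (Map (prod_cat T C D) y z) (Map (prod_cat T C D) x y)) t"
      have ts: "test_space T K"
        using K by (rule test_space_compact)
      note cg = test_space_imp_cg_space[OF ts]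
      have "continuous_map K (Map C y1 z1) (\<lambda>p. fst (fst (t p)))" "continuous_map K (Map D y2 z2) (\<lambda>p. snd (fst (t p)))"
        "continuous_map K (Map C x1 y1) (\<lambda>p. fst (snd (t p)))" "continuous_map K (Map D x2 y2) (\<lambda>p. snd (snd (t p)))"
        using t by (auto simp: eq prod_cat_def continuous_map_into_kprod cg)
      then show "continuous_map K (Map (prod_cat T C D) x z) ((\<lambda>(g, f). Comp (prod_cat T C D) x y z g f) \<circ> t)"
        using ob ts by (simp add: eq prod_cat_def continuous_map_into_kprod cg case_prod_beta
            C.continuous_map_Comp D.continuous_map_Comp)
    qed
  qed (auto simp: prod_cat_def kprod_def cg_space_kify C.Comp_assoc D.Comp_assoc)
qed

lemma weak_equivalence_in_prod_cat:
  fixes T :: "'k itself"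
  assumes "topological_category T C" "topological_category T D"
    and "weak_equivalence_in (prod_cat T C D) (x, y) (x', y') (f, g)"
  shows "weak_equivalence_in C x x' f" "weak_equivalence_in D y y' g"
proof -
  interpret C: top_category T C by unfold_locales fact
  interpret D: top_category T D by unfold_locales fact
  interpret P: top_category T "prod_cat T C D"
    by unfold_locales (intro topological_category_prod_cat assms)
  obtain h where h: "P.htpy_inverse (x, y) (x', y') (f, g) h"
    using assms(3) by (auto simp: P.weak_equivalence_in_iff)
  obtain f' g' where fg: "h = (f', g')"
    by (cases h)
  have "C.htpy_inverse x x' f f'" "D.htpy_inverse y y' g g'"
    using h unfolding fg P.htpy_inverse_def C.htpy_inverse_def D.htpy_inverse_def
    by (auto simp: prod_cat_def dest: path_component_of_kprod)
  then show "weak_equivalence_in C x x' f" "weak_equivalence_in D y y' g"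
    by (auto simp: C.weak_equivalence_in_iff D.weak_equivalence_in_iff)
qed

section \<open>Moore paths\<close>

text \<open>Only the values of \<open>\<phi>\<close> on the interval from \<open>0\<close> to \<open>r\<close> matter.\<close>

definition moore_path :: "(real \<Rightarrow> 'a) \<Rightarrow> real \<Rightarrow> 'a moore_path" where
  "moore_path \<phi> r = (\<lambda>u\<in>{0..}. \<phi> (min u r), r)"

text \<open>A normal form: identities between Moore paths reduce to comparing lengths and the values
  up to that length.\<close>

lemma moore_space_cases:
  assumes "m \<in> topspace (moore_space T X)"
  obtains \<phi> r where "m = moore_path \<phi> r" "0 \<le> r" "\<And>u. 0 \<le> u \<Longrightarrow> \<phi> u \<in> topspace X"
    "continuous_map half_line X \<phi>"
proof -
  obtain \<alpha> r where m: "m = (\<alpha>, r)"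
    by (cases m)
  have a: "0 \<le> r" "\<alpha> \<in> extensional {0..}" "continuous_map half_line X \<alpha>" and c: "\<And>s. r \<le> s \<Longrightarrow> \<alpha> s = \<alpha> r"
    using assms unfolding topspace_moore_space m by blast+
  have "\<alpha> = (\<lambda>u\<in>{0..}. \<alpha> (min u r))"
  proof (rule ext)
    fix u
    show "\<alpha> u = (\<lambda>u\<in>{0..}. \<alpha> (min u r)) u"
      using a(2) c[of u] by (auto simp: extensional_def min_def)
  qed
  then have "m = moore_path \<alpha> r"
    by (simp add: m moore_path_def)
  then show ?thesis
    using that[of \<alpha> r] a(1,3) continuous_map_funspace[OF a(3)] by auto
qed

lemma moore_start_path [simp]: "0 \<le> r \<Longrightarrow> moore_start (moore_path \<phi> r) = \<phi> 0"
  and moore_end_path [simp]: "0 \<le> r \<Longrightarrow> moore_end (moore_path \<phi> r) = \<phi> r"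
  by (simp_all add: moore_start_def moore_end_def moore_path_def)

lemma moore_path_eqI:
  "r = s \<Longrightarrow> (\<And>u. 0 \<le> u \<Longrightarrow> u \<le> r \<Longrightarrow> \<phi> u = \<psi> u) \<Longrightarrow> 0 \<le> r \<Longrightarrow> moore_path \<phi> r = moore_path \<psi> s"
  by (auto simp: moore_path_def restrict_def min_def fun_eq_iff)

lemma moore_const_eq_path: "moore_const x = moore_path (\<lambda>_. x) 0"
  by (simp add: moore_const_def moore_path_def)

lemma moore_map_path: "moore_map h (moore_path \<phi> r) = moore_path (\<lambda>u. h (\<phi> u)) r"
  by (auto simp: moore_map_def moore_path_def)

text \<open>The condition that the ends match is what settles the case \<open>s = 0\<close>: beyond
  time \<open>r\<close> the left side then has the value \<open>\<psi> 0\<close>, whereas the right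
  side stops in the first branch at \<open>\<phi> r\<close>.\<close>

lemma moore_concat_path:
  "0 \<le> r \<Longrightarrow> 0 \<le> s \<Longrightarrow> \<phi> r = \<psi> 0 \<Longrightarrow> moore_concat (moore_path \<psi> s) (moore_path \<phi> r) =
    moore_path (\<lambda>u. if u \<le> r then \<phi> u else \<psi> (u - r)) (r + s)"
  by (auto simp: moore_concat_def moore_path_def restrict_def fun_eq_iff min_def)

lemma moore_start_const [simp]: "moore_start (moore_const x) = x"
  and moore_end_const [simp]: "moore_end (moore_const x) = x"
  by (simp_all add: moore_const_eq_path)

lemma moore_map_const [simp]: "moore_map h (moore_const x) = moore_const (h x)"
  by (simp add: moore_const_eq_path moore_map_path)

lemma moore_const_in: "x \<in> topspace X \<Longrightarrow> moore_const x \<in> topspace (moore_space T X)"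
proof -
  assume "x \<in> topspace X"
  then have "continuous_map half_line X (\<lambda>u. x)"
    by simp
  then have "continuous_map half_line X (\<lambda>u\<in>{0..}. x)"
    by (rule continuous_map_eq) simp
  then show ?thesis
    by (auto simp: topspace_moore_space moore_const_def)
qed

lemma moore_map_map: "moore_map h (moore_map k m) = moore_map (\<lambda>x. h (k x)) m"
  by (auto simp: moore_map_def case_prod_beta)

text \<open>Because constant paths have length 0, they are strict units for concatenation; this is
  where the unit laws of the path category come from.\<close>

lemma
  assumes "m \<in> topspace (moore_space T X)"
  shows moore_start_map: "moore_start (moore_map h m) = h (moore_start m)"
    and moore_end_map: "moore_end (moore_map h m) = h (moore_end m)"
    and moore_concat_const_left: "moore_concat (moore_const (moore_end m)) m = m"
    and moore_concat_const_right: "moore_concat m (moore_const (moore_start m)) = m"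
    and moore_map_cong: "(\<And>x. x \<in> topspace X \<Longrightarrow> h x = k x) \<Longrightarrow> moore_map h m = moore_map k m"
    and moore_map_ident: "(\<And>x. x \<in> topspace X \<Longrightarrow> h x = x) \<Longrightarrow> moore_map h m = m"
proof -
  obtain \<phi> r where m: "m = moore_path \<phi> r" and r: "0 \<le> r" and \<phi>: "\<And>u. 0 \<le> u \<Longrightarrow> \<phi> u \<in> topspace X"
    by (rule moore_space_cases[OF assms]) blast
  show "moore_start (moore_map h m) = h (moore_start m)" "moore_end (moore_map h m) = h (moore_end m)"
    using r by (simp_all add: m moore_map_path)
  show "moore_concat (moore_const (moore_end m)) m = m" "moore_concat m (moore_const (moore_start m)) = m"
    using r by (simp_all add: m moore_const_eq_path moore_concat_path)
      (auto intro!: moore_path_eqI)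
  show "moore_map h m = moore_map k m" if "\<And>x. x \<in> topspace X \<Longrightarrow> h x = k x"
    using r that by (simp add: m moore_map_path \<phi> cong: moore_path_eqI)
  show "moore_map h m = m" if "\<And>x. x \<in> topspace X \<Longrightarrow> h x = x"
    using r that by (simp add: m moore_map_path \<phi> cong: moore_path_eqI)
qed

lemma
  assumes "m \<in> topspace (moore_space T X)" "n \<in> topspace (moore_space T X)" "moore_end m = moore_start n"
  shows moore_end_concat: "moore_end (moore_concat n m) = moore_end n"
    and moore_start_concat: "moore_start (moore_concat n m) = moore_start m"
    and moore_map_concat: "moore_map h (moore_concat n m) = moore_concat (moore_map h n) (moore_map h m)"
proof -
  obtain \<phi> r where m: "m = moore_path \<phi> r" and r: "0 \<le> r"
    by (rule moore_space_cases[OF assms(1)]) blast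
  obtain \<psi> s where n: "n = moore_path \<psi> s" and s: "0 \<le> s"
    by (rule moore_space_cases[OF assms(2)]) blast
  have "\<phi> r = \<psi> 0"
    using assms(3) r s by (simp add: m n)
  then show "moore_end (moore_concat n m) = moore_end n" "moore_start (moore_concat n m) = moore_start m"
    "moore_map h (moore_concat n m) = moore_concat (moore_map h n) (moore_map h m)"
    using r s by (auto simp: m n moore_map_path moore_concat_path if_distrib)
qed

lemma moore_concat_assoc:
  assumes "m \<in> topspace (moore_space T X)" "n \<in> topspace (moore_space T X)" "k \<in> topspace (moore_space T X)"
    and "moore_end m = moore_start n" "moore_end n = moore_start k"
  shows "moore_concat (moore_concat k n) m = moore_concat k (moore_concat n m)"
proof -
  obtain \<phi> r where m: "m = moore_path \<phi> r" and r: "0 \<le> r"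
    by (rule moore_space_cases[OF assms(1)]) blast
  obtain \<psi> s where n: "n = moore_path \<psi> s" and s: "0 \<le> s"
    by (rule moore_space_cases[OF assms(2)]) blast
  obtain \<omega> t where k: "k = moore_path \<omega> t" and t: "0 \<le> t"
    by (rule moore_space_cases[OF assms(3)]) blast
  have eq: "\<phi> r = \<psi> 0" "\<psi> s = \<omega> 0"
    using assms(4,5) r s t by (simp_all add: m n k)
  \<comment> \<open>The piecewise function for \<open>n\<close> after \<open>m\<close> has to end at
    \<open>\<omega> 0\<close>. For \<open>s = 0\<close> its last value comes from the first branch,
    and it is \<open>\<phi> r\<close>, equal to \<open>\<psi> 0\<close> and thus to
    \<open>\<omega> 0\<close>.\<close>
  then have "moore_concat k (moore_concat n m) =
      moore_path (\<lambda>u. if u \<le> r + s then if u \<le> r then \<phi> u else \<psi> (u - r) else \<omega> (u - (r + s))) (r + s + t)"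
    using r s t by (simp add: m n k moore_concat_path[of r s \<phi> \<psi>]) (rule moore_concat_path, auto)
  with eq show ?thesis
    using r s t by (simp add: m n k moore_concat_path) (auto simp: algebra_simps intro!: moore_path_eqI)
qed

section \<open>Continuity of the operations on families of Moore paths\<close>

lemma continuous_map_compose_fst: "continuous_map A X f \<Longrightarrow> continuous_map (prod_topology A B) X (\<lambda>x. f (fst x))"
  using continuous_map_compose[OF continuous_map_fst] by (fastforce simp: comp_def)

lemma continuous_map_half_line_snd: "continuous_map (prod_topology A half_line) euclideanreal snd"
  using continuous_map_snd[of A half_line] by (simp add: continuous_map_in_subtopology)

text \<open>Continuity is required only after the time has been cut off at \<open>r\<close>. So
  \<phi> may be a function that makes sense only up to the length, such as a homotopy on the unit
  interval or a path run backwards.\<close>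

lemma continuous_map_moore_path:
  assumes A: "test_space T A" and r: "continuous_map A euclideanreal r" "\<And>p. p \<in> topspace A \<Longrightarrow> 0 \<le> r p"
    and \<phi>: "continuous_map (prod_topology A half_line) X (\<lambda>x. \<phi> (fst x) (min (snd x) (r (fst x))))"
  shows "continuous_map A (moore_space T X) (\<lambda>p. moore_path (\<phi> p) (r p))"
  unfolding continuous_map_into_moore_space[OF A]
proof (intro conjI ballI allI impI)
  show "continuous_map A half_line (\<lambda>a. snd (moore_path (\<phi> a) (r a)))"
    using r by (auto simp: moore_path_def continuous_map_in_subtopology)
  show "continuous_map (prod_topology A half_line) X (\<lambda>(a, u). fst (moore_path (\<phi> a) (r a)) u)"
    by (rule continuous_map_eq[OF \<phi>]) (auto simp: moore_path_def)
next
  fix p s assume "p \<in> topspace A" "snd (moore_path (\<phi> p) (r p)) \<le> s"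
  then show "fst (moore_path (\<phi> p) (r p)) s = fst (moore_path (\<phi> p) (r p)) (snd (moore_path (\<phi> p) (r p)))"
    using r(2)[of p] by (auto simp: moore_path_def min_def)
qed (simp add: moore_path_def)

lemma continuous_map_moore_spaceE:
  assumes A: "test_space T A" and m: "continuous_map A (moore_space T X) m"
  obtains \<phi> r where "continuous_map A euclideanreal r" "\<And>p. p \<in> topspace A \<Longrightarrow> 0 \<le> r p"
    "continuous_map (prod_topology A half_line) X (\<lambda>(p, u). \<phi> p u)"
    "\<And>p. p \<in> topspace A \<Longrightarrow> m p = moore_path (\<phi> p) (r p)"
proof (rule that)
  note * = m[unfolded continuous_map_into_moore_space[OF A]]
  show r: "continuous_map A euclideanreal (\<lambda>p. snd (m p))" "\<And>p. p \<in> topspace A \<Longrightarrow> 0 \<le> snd (m p)"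
    using * by (auto simp: continuous_map_in_subtopology)
  show "continuous_map (prod_topology A half_line) X (\<lambda>(p, u). fst (m p) u)"
    using * by blast
  fix p assume p: "p \<in> topspace A"
  then have ext: "fst (m p) \<in> extensional {0..}"
    and c: "\<And>s. snd (m p) \<le> s \<Longrightarrow> fst (m p) s = fst (m p) (snd (m p))"
    using * by blast+
  have "fst (m p) u = (\<lambda>u\<in>{0..}. fst (m p) (min u (snd (m p)))) u" for u
    using ext c[of u] by (auto simp: extensional_def min_def)
  then show "m p = moore_path (fst (m p)) (snd (m p))"
    by (simp add: moore_path_def prod_eq_iff fun_eq_iff)
qed

lemma continuous_map_moore_const:
  assumes "test_space T A" "continuous_map A X f"
  shows "continuous_map A (moore_space T X) (\<lambda>p. moore_const (f p))"
  unfolding moore_const_eq_path using assms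
  by (intro continuous_map_moore_path) (auto intro: continuous_map_compose_fst)

text \<open>The family \<open>h\<close> is required to preserve continuous families instead of being
  continuous on a product with \<open>X\<close>: composition with a varying morphism is controlled
  only over test spaces, by \<open>continuous_map_Comp\<close>.\<close>

lemma continuous_map_moore_map:
  assumes A: "test_space T A" and m: "continuous_map A (moore_space T X) m"
    and h: "\<And>\<phi>. continuous_map (prod_topology A half_line) X (\<lambda>x. \<phi> (fst x) (snd x)) \<Longrightarrow>
      continuous_map (prod_topology A half_line) Y (\<lambda>x. h (fst x) (\<phi> (fst x) (snd x)))"
  shows "continuous_map A (moore_space T Y) (\<lambda>p. moore_map (h p) (m p))"
proof -
  obtain \<phi> r where r: "continuous_map A euclideanreal r" "\<And>p. p \<in> topspace A \<Longrightarrow> 0 \<le> r p"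
    and \<phi>: "continuous_map (prod_topology A half_line) X (\<lambda>(p, u). \<phi> p u)"
    and m: "\<And>p. p \<in> topspace A \<Longrightarrow> m p = moore_path (\<phi> p) (r p)"
    by (rule continuous_map_moore_spaceE[OF A m]) blast
  have "continuous_map A (moore_space T Y) (\<lambda>p. moore_path (\<lambda>u. h p (\<phi> p u)) (r p))"
  proof (rule continuous_map_moore_path[OF A r])
    have "continuous_map (prod_topology A half_line) half_line (\<lambda>x. min (snd x) (r (fst x)))"
      using r by (auto simp: continuous_map_in_subtopology
          intro!: continuous_map_real_min continuous_map_half_line_snd continuous_map_compose_fst)
    then have "continuous_map (prod_topology A half_line) X (\<lambda>x. \<phi> (fst x) (min (snd x) (r (fst x))))"
      by (intro continuous_map_eval[OF \<phi>] continuous_map_fst)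
    then show "continuous_map (prod_topology A half_line) Y (\<lambda>x. h (fst x) (\<phi> (fst x) (min (snd x) (r (fst x)))))"
      by (rule h[of "\<lambda>p u. \<phi> p (min u (r p))"])
  qed
  then show ?thesis
    by (rule continuous_map_eq) (simp add: m moore_map_path)
qed

lemma continuous_map_moore_concat:
  assumes A: "test_space T A"
    and m: "continuous_map A (moore_space T X) m" and n: "continuous_map A (moore_space T X) n"
    and mn: "\<And>p. p \<in> topspace A \<Longrightarrow> moore_end (m p) = moore_start (n p)"
  shows "continuous_map A (moore_space T X) (\<lambda>p. moore_concat (n p) (m p))"
proof -
  obtain \<phi> r where r: "continuous_map A euclideanreal r" "\<And>p. p \<in> topspace A \<Longrightarrow> 0 \<le> r p"
    and \<phi>: "continuous_map (prod_topology A half_line) X (\<lambda>(p, u). \<phi> p u)"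
    and m: "\<And>p. p \<in> topspace A \<Longrightarrow> m p = moore_path (\<phi> p) (r p)"
    by (rule continuous_map_moore_spaceE[OF A m]) blast
  obtain \<psi> s where s: "continuous_map A euclideanreal s" "\<And>p. p \<in> topspace A \<Longrightarrow> 0 \<le> s p"
    and \<psi>: "continuous_map (prod_topology A half_line) X (\<lambda>(p, u). \<psi> p u)"
    and n: "\<And>p. p \<in> topspace A \<Longrightarrow> n p = moore_path (\<psi> p) (s p)"
    by (rule continuous_map_moore_spaceE[OF A n]) blast
  have eq: "\<phi> p (r p) = \<psi> p 0" if "p \<in> topspace A" for p
    using mn[OF that] by (simp add: that m n r s)
  let ?B = "prod_topology A half_line"
  let ?u = "\<lambda>x. min (snd x) (r (fst x) + s (fst x))"
  have u: "continuous_map ?B euclideanreal ?u"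
    using r s by (intro continuous_map_real_min continuous_map_half_line_snd continuous_map_add continuous_map_compose_fst)
  \<comment> \<open>The two branches are glued along the closed sets on either side of
    \<open>r\<close>. The \<open>max 0\<close> keeps the argument of \<psi> in the half line
    everywhere, so this branch is continuous on all of \<open>?B\<close> before it is restricted; it
    changes nothing where the branch is used.\<close>
  have "continuous_map ?B X (\<lambda>x. if ?u x \<le> r (fst x) then \<phi> (fst x) (?u x)
      else \<psi> (fst x) (max 0 (?u x - r (fst x))))"
  proof (rule continuous_map_cases_le[OF u])
    show "continuous_map ?B euclideanreal (\<lambda>x. r (fst x))"
      using r by (intro continuous_map_compose_fst)
    show "continuous_map (subtopology ?B {x \<in> topspace ?B. ?u x \<le> r (fst x)}) X (\<lambda>x. \<phi> (fst x) (?u x))"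
      using u r s by (intro continuous_map_from_subtopology continuous_map_eval[OF \<phi>] continuous_map_fst)
        (auto simp: continuous_map_in_subtopology)
    show "continuous_map (subtopology ?B {x \<in> topspace ?B. r (fst x) \<le> ?u x}) X
        (\<lambda>x. \<psi> (fst x) (max 0 (?u x - r (fst x))))"
      using u r s by (intro continuous_map_from_subtopology continuous_map_eval[OF \<psi>] continuous_map_fst)
        (auto simp: continuous_map_in_subtopology
          intro!: continuous_map_real_max continuous_map_diff u continuous_map_compose_fst)
  next
    fix x assume "x \<in> topspace ?B" "?u x = r (fst x)"
    then show "\<phi> (fst x) (?u x) = \<psi> (fst x) (max 0 (?u x - r (fst x)))"
      using eq by auto
  qed
  then have "continuous_map ?B X (\<lambda>x. (\<lambda>u. if u \<le> r (fst x) then \<phi> (fst x) u else \<psi> (fst x) (u - r (fst x))) (?u x))"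
    by (rule continuous_map_eq) (auto simp: max_def)
  then have "continuous_map A (moore_space T X)
      (\<lambda>p. moore_path (\<lambda>u. if u \<le> r p then \<phi> p u else \<psi> p (u - r p)) (r p + s p))"
    using A r s by (intro continuous_map_moore_path continuous_map_add) auto
  then show ?thesis
    by (rule continuous_map_eq) (simp add: m n r s eq moore_concat_path)
qed

section \<open>The path category\<close>

context top_category
begin

abbreviation "P \<equiv> path_cat T C"

lemma Ob_path_cat: "Ob P = {(x, y, a). weak_equivalence_in C x y a}"
  by (simp add: path_cat_def)

lemma cg_space_path_Map: "cg_space T (Map P (x, y, a) (x', y', b))"
  by (simp add: path_cat_def kpullback_def ksub_def cg_space_kify)

lemma topspace_path_Map:
  "topspace (Map P (x, y, a) (x', y', b)) = {((f, g), m). f \<in> Hom x x' \<and> g \<in> Hom y y' \<and>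
     m \<in> topspace (moore_space T (Map C x y')) \<and>
     moore_start m = Comp C x y y' g a \<and> moore_end m = Comp C x x' y' b f}"
  by (auto simp: path_cat_def kpullback_def)

lemma continuous_map_into_path_Map:
  assumes "test_space T A"
  shows "continuous_map A (Map P (x, y, a) (x', y', b)) \<phi> \<longleftrightarrow>
    continuous_map A (Map C x x') (\<lambda>p. fst (fst (\<phi> p))) \<and>
    continuous_map A (Map C y y') (\<lambda>p. snd (fst (\<phi> p))) \<and>
    continuous_map A (moore_space T (Map C x y')) (\<lambda>p. snd (\<phi> p)) \<and>
    (\<forall>p\<in>topspace A. moore_start (snd (\<phi> p)) = Comp C x y y' (snd (fst (\<phi> p))) a \<and>
                    moore_end (snd (\<phi> p)) = Comp C x x' y' b (fst (fst (\<phi> p))))"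
  using test_space_imp_cg_space[OF assms]
  by (auto simp: path_cat_def kpullback_def continuous_map_into_ksub continuous_map_into_kprod case_prod_beta)

lemma path_Comp:
  "Comp P (x, y, a) (x', y', b) (x'', y'', c) ((f', g'), n) ((f, g), m) =
    ((Comp C x x' x'' f' f, Comp C y y' y'' g' g),
     moore_concat (moore_map (\<lambda>h. Comp C x x' y'' h f) n) (moore_map (\<lambda>h. Comp C x y' y'' g' h) m))"
  by (simp add: path_cat_def)

lemma path_Id: "Id P (x, y, a) = ((Id C x, Id C y), moore_const a)"
  by (simp add: path_cat_def)

lemma continuous_map_moore_precomp:
  assumes "x \<in> Ob C" "y \<in> Ob C" "z \<in> Ob C" "test_space T A"
    and "continuous_map A (moore_space T (Map C y z)) m" "continuous_map A (Map C x y) f"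
  shows "continuous_map A (moore_space T (Map C x z)) (\<lambda>p. moore_map (\<lambda>h. Comp C x y z h (f p)) (m p))"
  using assms
  by (intro continuous_map_moore_map continuous_map_Comp continuous_map_compose_fst test_space_prod_topology)
     auto

lemma continuous_map_moore_postcomp:
  assumes "x \<in> Ob C" "y \<in> Ob C" "z \<in> Ob C" "test_space T A"
    and "continuous_map A (moore_space T (Map C x y)) m" "continuous_map A (Map C y z) g"
  shows "continuous_map A (moore_space T (Map C x z)) (\<lambda>p. moore_map (\<lambda>h. Comp C x y z (g p) h) (m p))"
  using assms
  by (intro continuous_map_moore_map continuous_map_Comp continuous_map_compose_fst test_space_prod_topology)
     auto

lemma continuous_map_moore_space_element:
  "continuous_map A (moore_space T X) m \<Longrightarrow> p \<in> topspace A \<Longrightarrow> m p \<in> topspace (moore_space T X)"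
  using continuous_map_funspace by blast

text \<open>A single Moore path is treated as a constant family over the interval and evaluated at
  0, so the statement about families applies. The same holds for
  \<open>moore_postcomp\<close>.\<close>

lemma moore_precomp:
  assumes "x \<in> Ob C" "y \<in> Ob C" "z \<in> Ob C" "m \<in> topspace (moore_space T (Map C y z))" "f \<in> Hom x y"
  shows "moore_map (\<lambda>h. Comp C x y z h f) m \<in> topspace (moore_space T (Map C x z))"
  using continuous_map_moore_precomp[OF assms(1-3) test_space_interval, of "\<lambda>_. m" "\<lambda>_. f"] assms
    continuous_map_moore_space_element[of "top_of_set {0..1::real}" _ _ 0] by auto

lemma moore_postcomp:
  assumes "x \<in> Ob C" "y \<in> Ob C" "z \<in> Ob C" "m \<in> topspace (moore_space T (Map C x y))" "g \<in> Hom y z"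
  shows "moore_map (\<lambda>h. Comp C x y z g h) m \<in> topspace (moore_space T (Map C x z))"
  using continuous_map_moore_postcomp[OF assms(1-3) test_space_interval, of "\<lambda>_. m" "\<lambda>_. g"] assms
    continuous_map_moore_space_element[of "top_of_set {0..1::real}" _ _ 0] by auto

lemma continuous_map_path_Comp:
  assumes "(x, y, a) \<in> Ob P" "(x', y', b) \<in> Ob P" "(x'', y'', c) \<in> Ob P" "test_space T A"
    and \<psi>: "continuous_map A (Map P (x', y', b) (x'', y'', c)) \<psi>"
    and \<phi>: "continuous_map A (Map P (x, y, a) (x', y', b)) \<phi>"
  shows "continuous_map A (Map P (x, y, a) (x'', y'', c))
    (\<lambda>p. Comp P (x, y, a) (x', y', b) (x'', y'', c) (\<psi> p) (\<phi> p))"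
proof -
  have ob: "x \<in> Ob C" "y \<in> Ob C" "x' \<in> Ob C" "y' \<in> Ob C" "x'' \<in> Ob C" "y'' \<in> Ob C"
    and abc: "a \<in> Hom x y" "b \<in> Hom x' y'" "c \<in> Hom x'' y''"
    using assms by (auto simp: Ob_path_cat weak_equivalence_in_def)
  define f g m where "f = (\<lambda>p. fst (fst (\<phi> p)))" and "g = (\<lambda>p. snd (fst (\<phi> p)))" and "m = (\<lambda>p. snd (\<phi> p))"
  define f' g' n where "f' = (\<lambda>p. fst (fst (\<psi> p)))" and "g' = (\<lambda>p. snd (fst (\<psi> p)))" and "n = (\<lambda>p. snd (\<psi> p))"
  have \<phi>_eq: "\<phi> p = ((f p, g p), m p)" and \<psi>_eq: "\<psi> p = ((f' p, g' p), n p)" for p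
    by (simp_all add: f_def g_def m_def f'_def g'_def n_def)
  have c: "continuous_map A (Map C x x') f" "continuous_map A (Map C y y') g"
      "continuous_map A (moore_space T (Map C x y')) m"
      "continuous_map A (Map C x' x'') f'" "continuous_map A (Map C y' y'') g'"
      "continuous_map A (moore_space T (Map C x' y'')) n"
    and e: "\<And>p. p \<in> topspace A \<Longrightarrow> moore_start (m p) = Comp C x y y' (g p) a"
      "\<And>p. p \<in> topspace A \<Longrightarrow> moore_end (m p) = Comp C x x' y' b (f p)"
      "\<And>p. p \<in> topspace A \<Longrightarrow> moore_start (n p) = Comp C x' y' y'' (g' p) b"
      "\<And>p. p \<in> topspace A \<Longrightarrow> moore_end (n p) = Comp C x' x'' y'' c (f' p)"
    using \<phi> \<psi> by (simp_all add: continuous_map_into_path_Map assms(4) f_def g_def m_def f'_def g'_def n_def)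
  have el: "f p \<in> Hom x x'" "g p \<in> Hom y y'" "f' p \<in> Hom x' x''" "g' p \<in> Hom y' y''"
    "m p \<in> topspace (moore_space T (Map C x y'))" "n p \<in> topspace (moore_space T (Map C x' y''))"
    if "p \<in> topspace A" for p
    using c[THEN continuous_map_funspace] that by blast+
  let ?m = "\<lambda>p. moore_map (\<lambda>h. Comp C x y' y'' (g' p) h) (m p)"
  let ?n = "\<lambda>p. moore_map (\<lambda>h. Comp C x x' y'' h (f p)) (n p)"
  have mn: "continuous_map A (moore_space T (Map C x y'')) ?m" "continuous_map A (moore_space T (Map C x y'')) ?n"
    using ob c assms(4) by (auto intro!: continuous_map_moore_precomp continuous_map_moore_postcomp)
  \<comment> \<open>Both ends are g' b f, bracketed in the two possible ways.\<close>
  have match: "moore_end (?m p) = moore_start (?n p)" if "p \<in> topspace A" for p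
    using that ob abc el by (simp add: e moore_start_map[OF el(6)] moore_end_map[OF el(5)] Comp_assoc)
  have "continuous_map A (Map P (x, y, a) (x'', y'', c)) (\<lambda>p. ((Comp C x x' x'' (f' p) (f p),
      Comp C y y' y'' (g' p) (g p)), moore_concat (?n p) (?m p)))"
    unfolding continuous_map_into_path_Map[OF assms(4)] fst_conv snd_conv
  proof (intro conjI ballI)
    fix p assume p: "p \<in> topspace A"
    note in_ms = mn[THEN continuous_map_moore_space_element, OF p]
    show "moore_start (moore_concat (?n p) (?m p)) = Comp C x y y'' (Comp C y y' y'' (g' p) (g p)) a"
      using p ob abc el by (simp add: moore_start_concat[OF in_ms match] moore_start_map[OF el(5)] e Comp_assoc)
    show "moore_end (moore_concat (?n p) (?m p)) = Comp C x x'' y'' c (Comp C x x' x'' (f' p) (f p))"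
      using p ob abc el
      by (simp add: moore_end_concat[OF in_ms match] moore_end_map[OF el(6)] e Comp_assoc)
  qed (use ob c assms(4) mn match in \<open>auto intro!: continuous_map_Comp continuous_map_moore_concat\<close>)
  then show ?thesis
    by (simp add: \<phi>_eq \<psi>_eq path_Comp)
qed

lemma topological_category_path_cat: "topological_category T P"
  unfolding topological_category_def
proof (intro conjI)
  show "\<forall>x\<in>Ob P. \<forall>y\<in>Ob P. cg_space T (Map P x y)"
    by (auto simp: cg_space_path_Map)
  show "\<forall>x\<in>Ob P. Id P x \<in> topspace (Map P x x)"
  proof clarify
    fix x y a assume "(x, y, a) \<in> Ob P"
    then have xya: "x \<in> Ob C" "y \<in> Ob C" "a \<in> Hom x y"
      by (auto simp: Ob_path_cat weak_equivalence_in_def)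
    then show "Id P (x, y, a) \<in> topspace (Map P (x, y, a) (x, y, a))"
      using xya by (simp add: path_Id topspace_path_Map moore_const_in)
  qed
  show "\<forall>x\<in>Ob P. \<forall>y\<in>Ob P. \<forall>z\<in>Ob P.
      continuous_map (kprod T (Map P y z) (Map P x y)) (Map P x z) (\<lambda>(g, f). Comp P x y z g f)"
  proof (intro ballI)
    fix x y z assume ob: "x \<in> Ob P" "y \<in> Ob P" "z \<in> Ob P"
    show "continuous_map (kprod T (Map P y z) (Map P x y)) (Map P x z) (\<lambda>(g, f). Comp P x y z g f)"
    proof (rule continuous_map_from_cg_space)
      show "cg_space T (kprod T (Map P y z) (Map P x y))"
        unfolding kprod_def by (rule cg_space_kify)
      fix K :: "('k + real) topology" and t
      assume K: "compact_space K" "Hausdorff_space K"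
        and t: "continuous_map K (kprod T (Map P y z) (Map P x y)) t"
      have ts: "test_space T K"
        using K by (rule test_space_compact)
      show "continuous_map K (Map P x z) ((\<lambda>(g, f). Comp P x y z g f) \<circ> t)"
        using t ob ts
        by (cases x, cases y, cases z)
           (auto simp: continuous_map_into_kprod test_space_imp_cg_space case_prod_beta comp_def
             intro!: continuous_map_path_Comp)
    qed
  qed
  show "\<forall>x\<in>Ob P. \<forall>y\<in>Ob P. \<forall>f\<in>topspace (Map P x y). Comp P x x y f (Id P x) = f \<and> Comp P x y y (Id P y) f = f"
  proof clarify
    fix x y a x' y' b f g \<alpha> r
    assume "(x, y, a) \<in> Ob P" "(x', y', b) \<in> Ob P"
      and F: "((f, g), (\<alpha>, r)) \<in> topspace (Map P (x, y, a) (x', y', b))"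
    then have ob: "x \<in> Ob C" "y \<in> Ob C" "x' \<in> Ob C" "y' \<in> Ob C" "a \<in> Hom x y" "b \<in> Hom x' y'"
      by (auto simp: Ob_path_cat weak_equivalence_in_def)
    define m where "m = (\<alpha>, r)"
    have m: "m \<in> topspace (moore_space T (Map C x y'))" and fg: "f \<in> Hom x x'" "g \<in> Hom y y'"
      and e: "Comp C x y y' g a = moore_start m" "Comp C x x' y' b f = moore_end m"
      using F by (auto simp: topspace_path_Map m_def)
    have "moore_map (\<lambda>h. Comp C x x y' h (Id C x)) m = m" "moore_map (\<lambda>h. Comp C x y' y' (Id C y') h) m = m"
      using ob by (auto intro!: moore_map_ident[OF m])
    then show "Comp P (x, y, a) (x, y, a) (x', y', b) ((f, g), (\<alpha>, r)) (Id P (x, y, a)) = ((f, g), (\<alpha>, r)) \<and>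
        Comp P (x, y, a) (x', y', b) (x', y', b) (Id P (x', y', b)) ((f, g), (\<alpha>, r)) = ((f, g), (\<alpha>, r))"
      using ob fg moore_concat_const_left[OF m] moore_concat_const_right[OF m]
      unfolding m_def[symmetric] by (simp add: path_Id path_Comp e)
  qed
  show "\<forall>w\<in>Ob P. \<forall>x\<in>Ob P. \<forall>y\<in>Ob P. \<forall>z\<in>Ob P.
      \<forall>f\<in>topspace (Map P w x). \<forall>g\<in>topspace (Map P x y). \<forall>h\<in>topspace (Map P y z).
        Comp P w x z (Comp P x y z h g) f = Comp P w y z h (Comp P w x y g f)"
  proof (intro ballI)
    fix A1 A2 A3 A4 F G H
    assume O: "A1 \<in> Ob P" "A2 \<in> Ob P" "A3 \<in> Ob P" "A4 \<in> Ob P"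
      and M: "F \<in> topspace (Map P A1 A2)" "G \<in> topspace (Map P A2 A3)" "H \<in> topspace (Map P A3 A4)"
    obtain w w' a x x' b y y' c z z' d where A: "A1 = (w, w', a)" "A2 = (x, x', b)" "A3 = (y, y', c)" "A4 = (z, z', d)"
      by (metis prod_cases3)
    obtain f f' m g g' n h h' k where FGH: "F = ((f, f'), m)" "G = ((g, g'), n)" "H = ((h, h'), k)"
      by (metis prod.collapse)
    have ob: "w \<in> Ob C" "w' \<in> Ob C" "x \<in> Ob C" "x' \<in> Ob C" "y \<in> Ob C" "y' \<in> Ob C" "z \<in> Ob C" "z' \<in> Ob C"
      using O by (auto simp: A Ob_path_cat weak_equivalence_in_def)
    have mor: "f \<in> Hom w x" "f' \<in> Hom w' x'" "g \<in> Hom x y" "g' \<in> Hom x' y'" "h \<in> Hom y z" "h' \<in> Hom y' z'"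
      and m: "m \<in> topspace (moore_space T (Map C w x'))" and n: "n \<in> topspace (moore_space T (Map C x y'))"
      and k: "k \<in> topspace (moore_space T (Map C y z'))"
      and ends: "moore_end m = Comp C w x x' b f" "moore_start n = Comp C x x' y' g' b"
        "moore_end n = Comp C x y y' c g" "moore_start k = Comp C y y' z' h' c"
      and bc: "b \<in> Hom x x'" "c \<in> Hom y y'"
      using M O by (auto simp: A FGH topspace_path_Map Ob_path_cat weak_equivalence_in_def)
    \<comment> \<open>Both bracketings of the triple composite reduce to concatenations of the same
      three paths in the mapping space from \<open>w\<close> to \<open>z'\<close>: first h' g' m,
      then h' n f, then k g f.\<close>
    let ?k = "moore_map (\<lambda>e. Comp C w x z' (Comp C x y z' e g) f) k"
    let ?n = "moore_map (\<lambda>e. Comp C w x z' (Comp C x y' z' h' e) f) n"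
    let ?m = "moore_map (\<lambda>e. Comp C w x' z' (Comp C x' y' z' h' g') e) m"
    have *: "moore_map (\<lambda>e. Comp C w y z' e (Comp C w x y g f)) k = ?k"
      "moore_map (\<lambda>e. Comp C w y' z' h' (Comp C w x y' e f)) n = ?n"
      "moore_map (\<lambda>e. Comp C w y' z' h' (Comp C w x' y' g' e)) m = ?m"
      using ob mor by (auto intro!: moore_map_cong[OF k] moore_map_cong[OF n] moore_map_cong[OF m] simp: Comp_assoc)
    have K: "moore_map (\<lambda>e. Comp C x y z' e g) k \<in> topspace (moore_space T (Map C x z'))"
      and N: "moore_map (\<lambda>e. Comp C x y' z' h' e) n \<in> topspace (moore_space T (Map C x z'))"
      and N': "moore_map (\<lambda>e. Comp C w x y' e f) n \<in> topspace (moore_space T (Map C w y'))"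
      and M': "moore_map (\<lambda>e. Comp C w x' y' g' e) m \<in> topspace (moore_space T (Map C w y'))"
      using ob mor k n m by (auto intro!: moore_precomp moore_postcomp)
    have "moore_map (\<lambda>e. Comp C w x z' e f) (moore_map (\<lambda>e. Comp C x y z' e g) k) \<in> topspace (moore_space T (Map C w z'))"
      "moore_map (\<lambda>e. Comp C w x z' e f) (moore_map (\<lambda>e. Comp C x y' z' h' e) n) \<in> topspace (moore_space T (Map C w z'))"
      "?m \<in> topspace (moore_space T (Map C w z'))"
      using ob mor K N m by (auto intro!: moore_precomp moore_postcomp)
    from moore_concat_assoc[OF this(3,2,1)]
    have "moore_concat (moore_concat ?k ?n) ?m = moore_concat ?k (moore_concat ?n ?m)"
      using ob mor bc by (simp add: moore_map_map moore_start_map[OF n] moore_end_map[OF n] moore_start_map[OF k]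
          moore_end_map[OF m] ends Comp_assoc)
    then show "Comp P A1 A2 A4 (Comp P A2 A3 A4 H G) F = Comp P A1 A3 A4 H (Comp P A1 A2 A3 G F)"
      using ob mor bc by (simp add: A FGH path_Comp Comp_assoc moore_map_concat[OF N K]
          moore_map_concat[OF M' N'] moore_map_map * moore_start_map[OF n] moore_end_map[OF n]
          moore_start_map[OF k] moore_end_map[OF m] ends)
  qed
qed

end

section \<open>Paths and homotopies\<close>

lemma moore_path_in:
  assumes "0 \<le> r" "continuous_map half_line X (\<lambda>u. \<phi> (min u r))"
  shows "moore_path \<phi> r \<in> topspace (moore_space T X)"
proof -
  have "continuous_map half_line X (\<lambda>u\<in>{0..}. \<phi> (min u r))"
    using assms(2) by (rule continuous_map_eq) simp
  then show ?thesis
    using assms(1) by (auto simp: topspace_moore_space moore_path_def)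
qed

lemma moore_path_0: "moore_path \<phi> 0 = moore_const (\<phi> 0)"
  unfolding moore_const_eq_path by (rule moore_path_eqI) auto

text \<open>The length may be 0, so the path is run through by \<open>t * r\<close> for
  \<open>t\<close> in the unit interval. Together with \<open>moore_path_exists\<close> this
  identifies pairs of ends of Moore paths with homotopic pairs.\<close>

lemma path_component_of_moore:
  assumes "m \<in> topspace (moore_space T X)"
  shows "path_component_of X (moore_start m) (moore_end m)"
proof -
  obtain \<phi> r where m: "m = moore_path \<phi> r" "0 \<le> r" "continuous_map half_line X \<phi>"
    using moore_space_cases[OF assms] by blast
  have "continuous_map (top_of_set {0..1}) half_line (\<lambda>t. t * r)"
    using m(2) by (auto simp: continuous_map_in_subtopology intro!: continuous_intros)
  from continuous_map_compose[OF this m(3)] have "pathin X (\<lambda>t. \<phi> (t * r))"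
    by (simp add: pathin_def comp_def)
  then show ?thesis
    using m(2) unfolding path_component_of_def by (intro exI[of _ "\<lambda>t. \<phi> (t * r)"]) (simp add: m(1))
qed

lemma moore_path_exists:
  assumes "path_component_of X p q"
  obtains m where "m \<in> topspace (moore_space T X)" "moore_start m = p" "moore_end m = q"
proof -
  obtain \<gamma> where \<gamma>: "pathin X \<gamma>" "\<gamma> 0 = p" "\<gamma> 1 = q"
    using assms by (auto simp: path_component_of_def)
  have "continuous_map half_line (top_of_set {0..1}) (\<lambda>u. min u 1)"
    by (auto simp: continuous_map_in_subtopology intro!: continuous_intros)
  from continuous_map_compose[OF this \<gamma>(1)[unfolded pathin_def]]
  have "moore_path \<gamma> 1 \<in> topspace (moore_space T X)"
    by (intro moore_path_in) (simp_all add: comp_def)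
  then show ?thesis
    by (rule that) (simp_all add: \<gamma>)
qed

text \<open>The part of the path from time \<open>t * r\<close> on: as \<open>t\<close> runs from \<open>0\<close> to \<open>1\<close>, the path is contracted to its end.\<close>

definition moore_tail :: "real \<Rightarrow> 'a moore_path \<Rightarrow> 'a moore_path" where
  "moore_tail t = (\<lambda>(\<alpha>, r). moore_path (\<lambda>u. \<alpha> (t * r + u)) ((1 - t) * r))"

lemma moore_tail_path:
  assumes "0 \<le> r" "0 \<le> t" "t \<le> 1"
  shows "moore_tail t (moore_path \<phi> r) = moore_path (\<lambda>u. \<phi> (t * r + u)) ((1 - t) * r)"
proof -
  have "0 \<le> t * r" "t * r \<le> r"
    using assms by (simp_all add: mult_left_le_one_le)
  then show ?thesis
    using assms unfolding moore_tail_def moore_path_def[of _ r]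
    by (auto intro!: moore_path_eqI simp: algebra_simps min_def)
qed

lemma
  assumes "m \<in> topspace (moore_space T X)"
  shows moore_end_tail: "0 \<le> t \<Longrightarrow> t \<le> 1 \<Longrightarrow> moore_end (moore_tail t m) = moore_end m"
    and moore_tail_0: "moore_tail 0 m = m"
    and moore_tail_1: "moore_tail 1 m = moore_const (moore_end m)"
proof -
  obtain \<phi> r where m: "m = moore_path \<phi> r" "0 \<le> r"
    using moore_space_cases[OF assms(1)] by blast
  show "moore_end (moore_tail t m) = moore_end m" if "0 \<le> t" "t \<le> 1"
    using that m by (simp add: moore_tail_path) (simp add: algebra_simps)
  show "moore_tail 0 m = m" "moore_tail 1 m = moore_const (moore_end m)"
    using m by (simp_all add: moore_tail_path moore_path_0)
qed

lemma moore_tail_const: "0 \<le> t \<Longrightarrow> t \<le> 1 \<Longrightarrow> moore_tail t (moore_const x) = moore_const x"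
  by (simp add: moore_const_eq_path moore_tail_path)

lemma continuous_map_real_coordinate:
  "continuous_map (prod_topology (top_of_set S) A) euclideanreal fst"
  "continuous_map (prod_topology A (top_of_set S)) euclideanreal snd"
  using continuous_map_fst[of "top_of_set S" A] continuous_map_snd[of A "top_of_set S"]
  by (simp_all add: continuous_map_in_subtopology)

lemma continuous_map_compose_snd: "continuous_map A X f \<Longrightarrow> continuous_map (prod_topology B A) X (\<lambda>x. f (snd x))"
  using continuous_map_compose[OF continuous_map_snd] by (fastforce simp: comp_def)

text \<open>The second statement is needed because, in a morphism between identities, the target
  component equals the start of the path and must move along with it during the contraction.\<close>

lemma continuous_map_moore_tail:
  assumes A: "test_space T A" and m: "continuous_map A (moore_space T X) m"
  shows "continuous_map (prod_topology (top_of_set {0..1}) A) (moore_space T X) (\<lambda>x. moore_tail (fst x) (m (snd x)))"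
    and "continuous_map (prod_topology (top_of_set {0..1}) A) X (\<lambda>x. moore_start (moore_tail (fst x) (m (snd x))))"
proof -
  obtain \<phi> r where r: "continuous_map A euclideanreal r" "\<And>p. p \<in> topspace A \<Longrightarrow> 0 \<le> r p"
    and \<phi>: "continuous_map (prod_topology A half_line) X (\<lambda>(p, u). \<phi> p u)"
    and m: "\<And>p. p \<in> topspace A \<Longrightarrow> m p = moore_path (\<phi> p) (r p)"
    by (rule continuous_map_moore_spaceE[OF A m]) blast
  let ?B = "prod_topology (top_of_set {0..1::real}) A"
  have B: "test_space T ?B"
    using A by (intro test_space_prod_topology) simp_all
  have R: "continuous_map ?B euclideanreal (\<lambda>x. r (snd x))" "continuous_map ?B euclideanreal fst"
    by (rule continuous_map_compose_snd[OF r(1)], rule continuous_map_real_coordinate(1))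
  have s: "continuous_map ?B half_line (\<lambda>x. fst x * r (snd x))"
    using r R by (auto simp: continuous_map_in_subtopology intro!: continuous_map_real_mult)
  have "continuous_map (prod_topology ?B half_line) half_line
      (\<lambda>z. fst (fst z) * r (snd (fst z)) + min (snd z) ((1 - fst (fst z)) * r (snd (fst z))))"
    using r R continuous_map_compose_fst[OF R(1), of half_line] continuous_map_compose_fst[OF R(2), of half_line]
    by (auto simp: continuous_map_in_subtopology intro!: continuous_map_real_mult continuous_map_add
        continuous_map_real_min continuous_map_diff continuous_map_half_line_snd)
  then have "continuous_map (prod_topology ?B half_line) X
      (\<lambda>z. \<phi> (snd (fst z)) (fst (fst z) * r (snd (fst z)) + min (snd z) ((1 - fst (fst z)) * r (snd (fst z)))))"
    by (intro continuous_map_eval[OF \<phi>] continuous_map_compose_fst[OF continuous_map_snd])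
  then have "continuous_map ?B (moore_space T X)
      (\<lambda>x. moore_path (\<lambda>u. \<phi> (snd x) (fst x * r (snd x) + u)) ((1 - fst x) * r (snd x)))"
    using r R by (intro continuous_map_moore_path B) (auto intro!: continuous_map_real_mult continuous_map_diff)
  then show "continuous_map ?B (moore_space T X) (\<lambda>x. moore_tail (fst x) (m (snd x)))"
    by (rule continuous_map_eq) (auto simp: m r moore_tail_path)
  have "continuous_map ?B X (\<lambda>x. \<phi> (snd x) (fst x * r (snd x)))"
    using s by (intro continuous_map_eval[OF \<phi>] continuous_map_snd)
  then show "continuous_map ?B X (\<lambda>x. moore_start (moore_tail (fst x) (m (snd x))))"
    by (rule continuous_map_eq) (auto simp: m r moore_tail_path)
qed

section \<open>The path object\<close>

context top_category
begin

interpretation PC: top_category T P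
  by unfold_locales (rule topological_category_path_cat)

lemma enriched_functor_path_incl: "enriched_functor T C P (path_incl C)"
  unfolding enriched_functor_def
proof (intro conjI ballI topological_category topological_category_path_cat)
  fix x assume x: "x \<in> Ob C"
  show "F0 (path_incl C) x \<in> Ob P"
    using x by (simp add: path_incl_def Ob_path_cat weak_equivalence_in_Id)
  show "F1 (path_incl C) x x (Id C x) = Id P (F0 (path_incl C) x)"
    by (simp add: path_incl_def path_Id)
  fix y assume y: "y \<in> Ob C"
  show "continuous_map (Map C x y) (Map P (F0 (path_incl C) x) (F0 (path_incl C) y)) (F1 (path_incl C) x y)"
  proof (rule continuous_map_from_cg_space[OF cg_space_Map[OF x y]])
    fix K :: "('k + real) topology" and t
    assume K: "compact_space K" "Hausdorff_space K" and t: "continuous_map K (Map C x y) t"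
    then have "test_space T K" "\<And>p. p \<in> topspace K \<Longrightarrow> t p \<in> Hom x y"
      using continuous_map_funspace by (auto intro: test_space_compact)
    then show "continuous_map K (Map P (F0 (path_incl C) x) (F0 (path_incl C) y)) (F1 (path_incl C) x y \<circ> t)"
      using t x y by (auto simp: path_incl_def continuous_map_into_path_Map intro: continuous_map_moore_const)
  qed
  fix z f g assume z: "z \<in> Ob C" and fg: "f \<in> Hom x y" "g \<in> Hom y z"
  show "F1 (path_incl C) x z (Comp C x y z g f) = Comp P (F0 (path_incl C) x) (F0 (path_incl C) y)
      (F0 (path_incl C) z) (F1 (path_incl C) y z g) (F1 (path_incl C) x y f)"
    using moore_concat_const_left[OF moore_const_in[of "Comp C x y z g f" "Map C x z"]] x y z fg
    by (simp add: path_incl_def path_Comp)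
qed

lemma enriched_functor_ev: "enriched_functor T P (prod_cat T C C) (pair_functor ev_s ev_t)"
  unfolding enriched_functor_def
proof (intro conjI ballI topological_category_path_cat topological_category_prod_cat topological_category)
  fix X assume X: "X \<in> Ob P"
  show "F0 (pair_functor ev_s ev_t) X \<in> Ob (prod_cat T C C)"
    using X by (auto simp: pair_functor_def ev_s_def ev_t_def prod_cat_def Ob_path_cat weak_equivalence_in_def)
  show "F1 (pair_functor ev_s ev_t) X X (Id P X) = Id (prod_cat T C C) (F0 (pair_functor ev_s ev_t) X)"
    by (cases X) (simp add: pair_functor_def ev_s_def ev_t_def prod_cat_def path_Id)
  fix Y assume Y: "Y \<in> Ob P"
  show "continuous_map (Map P X Y) (Map (prod_cat T C C) (F0 (pair_functor ev_s ev_t) X)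
      (F0 (pair_functor ev_s ev_t) Y)) (F1 (pair_functor ev_s ev_t) X Y)"
  proof (rule continuous_map_from_cg_space[OF PC.cg_space_Map[OF X Y]])
    fix K :: "('k + real) topology" and t
    assume K: "compact_space K" "Hausdorff_space K" and t: "continuous_map K (Map P X Y) t"
    then have "test_space T K"
      by (intro test_space_compact)
    then show "continuous_map K (Map (prod_cat T C C) (F0 (pair_functor ev_s ev_t) X)
      (F0 (pair_functor ev_s ev_t) Y)) (F1 (pair_functor ev_s ev_t) X Y \<circ> t)"
      using t by (cases X, cases Y) (simp add: pair_functor_def ev_s_def ev_t_def prod_cat_def comp_def
          case_prod_beta continuous_map_into_path_Map continuous_map_into_kprod test_space_imp_cg_space)
  qed
  fix Z F G
  show "F1 (pair_functor ev_s ev_t) X Z (Comp P X Y Z G F) =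
      Comp (prod_cat T C C) (F0 (pair_functor ev_s ev_t) X) (F0 (pair_functor ev_s ev_t) Y) (F0 (pair_functor ev_s ev_t) Z)
        (F1 (pair_functor ev_s ev_t) Y Z G) (F1 (pair_functor ev_s ev_t) X Y F)"
    by (cases X, cases Y, cases Z, cases F, cases G)
       (auto simp: pair_functor_def ev_s_def ev_t_def prod_cat_def path_Comp case_prod_beta)
qed

text \<open>In a morphism (f, g, \<alpha>) between identities, \<alpha> runs from g to f.
  Contracting it to its end keeps f fixed and moves g along \<alpha> to f, so the retraction is the
  source component \<open>fst (fst F)\<close>. Constant paths of length 0 have themselves as tails
  and stay fixed.\<close>

lemma weak_homotopy_equivalence_path_incl:
  assumes x: "x \<in> Ob C" and y: "y \<in> Ob C"
  shows "weak_homotopy_equivalence (Map C x y) (Map P (x, x, Id C x) (y, y, Id C y)) (\<lambda>f. ((f, f), moore_const f))"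
proof (rule weak_homotopy_equivalence_deformation_retract[where p = "\<lambda>F. fst (fst F)" and
      H = "\<lambda>t F. ((fst (fst F), moore_start (moore_tail t (snd F))), moore_tail t (snd F))"])
  let ?M = "Map P (x, x, Id C x) (y, y, Id C y)"
  have mem: "fst (fst F) \<in> Hom x y" "snd F \<in> topspace (moore_space T (Map C x y))"
      "moore_start (snd F) = snd (fst F)" "moore_end (snd F) = fst (fst F)"
    if "F \<in> topspace ?M" for F
    using that x y by (auto simp: topspace_path_Map)
  show "continuous_map (Map C x y) ?M (\<lambda>f. ((f, f), moore_const f))"
    using enriched_functor_path_incl x y by (simp add: enriched_functor_def path_incl_def)
  show "continuous_map ?M (Map C x y) (\<lambda>F. fst (fst F))"
  proof (rule continuous_map_from_cg_space[OF cg_space_path_Map])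
    fix K :: "('k + real) topology" and t
    assume "compact_space K" "Hausdorff_space K" "continuous_map K ?M t"
    then show "continuous_map K (Map C x y) ((\<lambda>F. fst (fst F)) \<circ> t)"
      using continuous_map_into_path_Map[OF test_space_compact, of K] by (simp add: comp_def)
  qed
  show "((fst (fst F), moore_start (moore_tail 0 (snd F))), moore_tail 0 (snd F)) = F" if "F \<in> topspace ?M" for F
    using mem[OF that] by (simp add: moore_tail_0 prod_eq_iff)
  show "((fst (fst F), moore_start (moore_tail 1 (snd F))), moore_tail 1 (snd F)) =
      ((fst (fst F), fst (fst F)), moore_const (fst (fst F)))" if "F \<in> topspace ?M" for F
    using mem[OF that] by (simp add: moore_tail_1)
  fix n s assume s: "continuous_map (cube n) ?M s"
  have B: "test_space T (prod_topology (top_of_set {0..1::real}) (cube n))"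
    by (intro test_space_prod_topology) simp_all
  have c: "continuous_map (cube n) (Map C x y) (\<lambda>q. fst (fst (s q)))"
    and m: "continuous_map (cube n) (moore_space T (Map C x y)) (\<lambda>q. snd (s q))"
    using s by (simp_all add: continuous_map_into_path_Map)
  note tail = continuous_map_moore_tail[OF test_space_cube m]
  have sq: "s q \<in> topspace ?M" if "q \<in> topspace (cube n)" for q
    using continuous_map_funspace[OF s] that by blast
  have "moore_start (moore_tail t (snd (s q))) \<in> Hom x y" if "t \<in> {0..1}" "q \<in> topspace (cube n)" for t q
    using funcset_mem[OF continuous_map_funspace[OF tail(2)], of "(t, q)"] that by simp
  then show "continuous_map (prod_topology (top_of_set {0..1}) (cube n)) ?M
      (\<lambda>(t, q). ((fst (fst (s q)), moore_start (moore_tail t (snd (s q)))), moore_tail t (snd (s q))))"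
    unfolding continuous_map_into_path_Map[OF B] case_prod_beta fst_conv snd_conv
    using tail continuous_map_compose_snd[OF c] x y
    by (auto simp: moore_end_tail[OF mem(2)[OF sq]] mem[OF sq])
qed (simp_all add: moore_tail_const)

text \<open>
  The Moore path of a morphism is carried along a homotopy \<open>(f\<^sub>t, g\<^sub>t)\<close> by inserting the path
  \<open>u \<mapsto> g\<^bsub>t - u\<^esub> a\<close> before it and \<open>u \<mapsto> b f\<^sub>u\<close> after it, both of length \<open>t\<close>. At \<open>t = 0\<close> these
  have length \<open>0\<close>, so the lift starts at the given morphism on the nose.
\<close>

lemma path_Map_lift:
  assumes ob: "(x, y, a) \<in> Ob P" "(x', y', b) \<in> Ob P" and A: "test_space T A"
    and G: "continuous_map A (Map P (x, y, a) (x', y', b)) G"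
    and h: "continuous_map (prod_topology A (top_of_set {0..1::real})) (kprod T (Map C x x') (Map C y y')) h"
    and h0: "\<And>p. p \<in> topspace A \<Longrightarrow> h (p, 0) = fst (G p)"
  shows "\<exists>H. continuous_map (prod_topology A (top_of_set {0..1})) (Map P (x, y, a) (x', y', b)) H \<and>
    (\<forall>p\<in>topspace A. H (p, 0) = G p) \<and> (\<forall>p t. fst (H (p, t)) = h (p, t))"
proof -
  have o: "x \<in> Ob C" "y \<in> Ob C" "x' \<in> Ob C" "y' \<in> Ob C" "a \<in> Hom x y" "b \<in> Hom x' y'"
    using ob by (auto simp: Ob_path_cat weak_equivalence_in_def)
  let ?B = "prod_topology A (top_of_set {0..1::real})"
  have B: "test_space T ?B"
    using A by (intro test_space_prod_topology) simp_all
  have BH: "test_space T (prod_topology ?B half_line)"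
    by (rule test_space_prod_topology[OF B test_space_half_line])
  have hc: "continuous_map ?B (Map C x x') (\<lambda>z. fst (h z))" "continuous_map ?B (Map C y y') (\<lambda>z. snd (h z))"
    using h by (simp_all add: continuous_map_into_kprod test_space_imp_cg_space[OF B])
  have snd: "continuous_map ?B euclideanreal snd"
    by (rule continuous_map_real_coordinate)
  have m: "continuous_map A (moore_space T (Map C x y')) (\<lambda>p. snd (G p))"
    and e: "\<And>p. p \<in> topspace A \<Longrightarrow> moore_start (snd (G p)) = Comp C x y y' (snd (fst (G p))) a"
      "\<And>p. p \<in> topspace A \<Longrightarrow> moore_end (snd (G p)) = Comp C x x' y' b (fst (fst (G p)))"
    using G by (simp_all add: continuous_map_into_path_Map[OF A])
  define \<gamma> where "\<gamma> = (\<lambda>z. moore_path (\<lambda>u. Comp C x y y' (snd (h (fst z, snd z - u))) a) (snd z))"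
  define \<epsilon> where "\<epsilon> = (\<lambda>z. moore_path (\<lambda>u. Comp C x x' y' b (fst (h (fst z, u)))) (snd z))"
  have snd': "continuous_map (prod_topology ?B half_line) euclideanreal (\<lambda>w. snd (fst w))"
    using snd by (rule continuous_map_compose_fst)
  \<comment> \<open>The cut-off at \<open>snd (fst w)\<close> keeps both time arguments in the unit
    interval, the domain on which \<open>h\<close> is continuous.\<close>
  have "continuous_map (prod_topology ?B half_line) ?B (\<lambda>w. (fst (fst w), snd (fst w) - min (snd w) (snd (fst w))))"
    "continuous_map (prod_topology ?B half_line) ?B (\<lambda>w. (fst (fst w), min (snd w) (snd (fst w))))"
    using snd' by (auto simp: continuous_map_paired continuous_map_in_subtopology
        intro!: continuous_map_compose_fst[OF continuous_map_fst] continuous_map_diff continuous_map_real_min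
          continuous_map_half_line_snd)
  from continuous_map_compose[OF this(1) hc(2)] continuous_map_compose[OF this(2) hc(1)]
  have \<gamma>: "continuous_map ?B (moore_space T (Map C x y')) \<gamma>" and \<epsilon>: "continuous_map ?B (moore_space T (Map C x y')) \<epsilon>"
    unfolding \<gamma>_def \<epsilon>_def using o snd
    by (auto intro!: continuous_map_moore_path B continuous_map_Comp BH simp: comp_def)
  have m': "continuous_map ?B (moore_space T (Map C x y')) (\<lambda>z. snd (G (fst z)))"
    using m by (rule continuous_map_compose_fst)
  let ?m = "\<lambda>z. moore_concat (snd (G (fst z))) (\<gamma> z)"
  \<comment> \<open>At its last moment \<gamma> has reached time 0 of the homotopy, where
    \<open>h0\<close> identifies it with the start of the given path. In the same way \<epsilon>
    begins at time 0, at the end of the given path.\<close>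
  have 1: "moore_end (\<gamma> z) = moore_start (snd (G (fst z)))" if "z \<in> topspace ?B" for z
    using that by (auto simp: \<gamma>_def e h0)
  have m1: "continuous_map ?B (moore_space T (Map C x y')) ?m"
    by (intro continuous_map_moore_concat B \<gamma> m' 1)
  have ends1: "moore_start (?m z) = moore_start (\<gamma> z)" "moore_end (?m z) = moore_end (snd (G (fst z)))"
    if "z \<in> topspace ?B" for z
    using moore_start_concat moore_end_concat 1[OF that]
      continuous_map_moore_space_element[OF \<gamma> that] continuous_map_moore_space_element[OF m' that] by blast+
  have 2: "moore_end (?m z) = moore_start (\<epsilon> z)" if "z \<in> topspace ?B" for z
    using that by (subst ends1) (auto simp: \<epsilon>_def e h0)
  let ?n = "\<lambda>z. moore_concat (\<epsilon> z) (?m z)"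
  have n: "continuous_map ?B (moore_space T (Map C x y')) ?n"
    by (intro continuous_map_moore_concat B \<epsilon> m1 2)
  have ends2: "moore_start (?n z) = moore_start (\<gamma> z)" "moore_end (?n z) = moore_end (\<epsilon> z)"
    if "z \<in> topspace ?B" for z
    using moore_start_concat moore_end_concat 2[OF that] ends1[OF that]
      continuous_map_moore_space_element[OF \<epsilon> that] continuous_map_moore_space_element[OF m1 that] by metis+
  have "continuous_map ?B (Map P (x, y, a) (x', y', b)) (\<lambda>z. (h z, ?n z))"
    unfolding continuous_map_into_path_Map[OF B] fst_conv snd_conv
    using hc n ends2 by (auto simp: \<gamma>_def \<epsilon>_def)
  moreover have "(h (p, 0), ?n (p, 0)) = G p" if p: "p \<in> topspace A" for p
  proof -
    have "\<gamma> (p, 0) = moore_const (moore_start (snd (G p)))" "\<epsilon> (p, 0) = moore_const (moore_end (snd (G p)))"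
      using p by (simp_all add: \<gamma>_def \<epsilon>_def moore_path_0 e h0)
    then show ?thesis
      using continuous_map_moore_space_element[OF m p] p
      by (simp add: moore_concat_const_left moore_concat_const_right h0)
  qed
  ultimately show ?thesis
    by (intro exI[of _ "\<lambda>z. (h z, ?n z)"]) auto
qed

lemma serre_fibration_ev:
  assumes "(x, y, a) \<in> Ob P" "(x', y', b) \<in> Ob P"
  shows "serre_fibration (Map P (x, y, a) (x', y', b)) (kprod T (Map C x x') (Map C y y')) fst"
  unfolding serre_fibration_def
proof (intro conjI allI impI)
  show "continuous_map (Map P (x, y, a) (x', y', b)) (kprod T (Map C x x') (Map C y y')) fst"
  proof (rule continuous_map_from_cg_space[OF cg_space_path_Map])
    fix K :: "('k + real) topology" and t
    assume "compact_space K" "Hausdorff_space K" "continuous_map K (Map P (x, y, a) (x', y', b)) t"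
    then show "continuous_map K (kprod T (Map C x x') (Map C y y')) (fst \<circ> t)"
      using test_space_compact[of K T]
      by (simp add: continuous_map_into_path_Map continuous_map_into_kprod test_space_imp_cg_space)
  qed
  fix n g and h :: "(nat \<Rightarrow> real) \<times> real \<Rightarrow> 'm \<times> 'm"
  assume "continuous_map (cube n) (Map P (x, y, a) (x', y', b)) g \<and>
    continuous_map (prod_topology (cube n) (top_of_set {0..1})) (kprod T (Map C x x') (Map C y y')) h \<and>
    (\<forall>p\<in>topspace (cube n). h (p, 0) = fst (g p))"
  then show "\<exists>H. continuous_map (prod_topology (cube n) (top_of_set {0..1})) (Map P (x, y, a) (x', y', b)) H \<and>
      (\<forall>p\<in>topspace (cube n). H (p, 0) = g p) \<and> (\<forall>p\<in>topspace (cube n). \<forall>t\<in>{0..1}. fst (H (p, t)) = h (p, t))"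
    using path_Map_lift[OF assms test_space_cube, of n g h] by blast
qed

section \<open>Recognizing weak equivalences of the path category\<close>

lemma path_Map_transport:
  assumes ob: "(x, y, a) \<in> Ob P" "(x', y', b) \<in> Ob P"
    and F: "((f, g), m) \<in> topspace (Map P (x, y, a) (x', y', b))"
    and f: "htpy x x' f f1" and g: "htpy y y' g g1"
  obtains m1 where "PC.htpy (x, y, a) (x', y', b) ((f, g), m) ((f1, g1), m1)"
proof -
  obtain p q where p: "pathin (Map C x x') p" "p 0 = f" "p 1 = f1" and q: "pathin (Map C y y') q" "q 0 = g" "q 1 = g1"
    using f g by (auto simp: path_component_of_def)
  let ?I = "top_of_set {0..1::real}"
  \<comment> \<open>Path lifting from a point, with the interval standing in for the point: all data
    are constant in the first coordinate, and the lift is read off at 0.\<close>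
  have "continuous_map (prod_topology ?I ?I) (kprod T (Map C x x') (Map C y y')) (\<lambda>z. (p (snd z), q (snd z)))"
    using p q by (simp del: prod_topology_subtopology_eu add: continuous_map_into_kprod
        test_space_imp_cg_space test_space_prod_topology pathin_def continuous_map_compose_snd)
  then obtain H where H: "continuous_map (prod_topology ?I ?I) (Map P (x, y, a) (x', y', b)) H"
    "\<And>s. s \<in> {0..1} \<Longrightarrow> H (s, 0) = ((f, g), m)" "\<And>s t. fst (H (s, t)) = (p t, q t)"
    using path_Map_lift[OF ob test_space_interval, of "\<lambda>_. ((f, g), m)" "\<lambda>z. (p (snd z), q (snd z))"] F p q
    by (auto simp del: prod_topology_subtopology_eu)
  have "continuous_map ?I (prod_topology ?I ?I) (\<lambda>t. (0, t))"
    by (simp del: prod_topology_subtopology_eu add: continuous_map_paired)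
  from continuous_map_compose[OF this H(1)] have "pathin (Map P (x, y, a) (x', y', b)) (\<lambda>t. H (0, t))"
    by (simp add: pathin_def comp_def)
  then have "PC.htpy (x, y, a) (x', y', b) ((f, g), m) (H (0, 1))"
    using H(2)[of 0] unfolding path_component_of_def by (intro exI[of _ "\<lambda>t. H (0, t)"]) simp
  moreover have "H (0, 1) = ((f1, g1), snd (H (0, 1)))"
    using H(3)[of 0 1] p q by (simp add: prod_eq_iff)
  ultimately show ?thesis
    using that by metis
qed

text \<open>
  A loop followed by its reverse is contracted through the paths of length \<open>2 t r\<close> that turn
  round at time \<open>t r\<close>.
\<close>

lemma loop_contract:
  assumes ob: "(x, y, a) \<in> Ob P" and r: "0 \<le> r"
    and \<delta>: "continuous_map half_line (Map C x y) (\<lambda>u. \<delta> (min u r))" "\<delta> 0 = a" "\<delta> r = a"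
  shows "PC.htpy (x, y, a) (x, y, a)
    (Comp P (x, y, a) (x, y, a) (x, y, a) ((Id C x, Id C y), moore_path (\<lambda>u. \<delta> (r - u)) r)
      ((Id C x, Id C y), moore_path \<delta> r)) (Id P (x, y, a))"
proof -
  have o: "x \<in> Ob C" "y \<in> Ob C" "a \<in> Hom x y"
    using ob by (auto simp: Ob_path_cat weak_equivalence_in_def)
  let ?I = "top_of_set {0..1::real}"
  let ?p = "\<lambda>t. ((Id C x, Id C y), moore_path (\<lambda>u. \<delta> (min u (2 * t * r - u))) (2 * t * r))"
  have d: "\<delta> u \<in> Hom x y" if "0 \<le> u" "u \<le> r" for u
    using continuous_map_funspace[OF \<delta>(1)] that by (auto simp: Pi_iff min_def split: if_splits)
  have "continuous_map ?I (moore_space T (Map C x y)) (\<lambda>t. moore_path (\<lambda>u. \<delta> (min u (2 * t * r - u))) (2 * t * r))"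
  proof (rule continuous_map_moore_path)
    show "continuous_map ?I euclideanreal (\<lambda>t. 2 * t * r)"
      by (auto intro!: continuous_intros)
    let ?w = "\<lambda>x :: real \<times> real. min (snd x) (2 * fst x * r)"
    have tr: "0 \<le> t * r" "t * r \<le> r" if "0 \<le> t" "t \<le> 1" for t
      using r that by (simp_all add: mult_left_le_one_le)
    have "continuous_map (prod_topology ?I half_line) half_line (\<lambda>x. min (?w x) (2 * fst x * r - ?w x))"
      using tr continuous_map_real_coordinate(1)[of "{0..1}" half_line]
      by (auto simp del: prod_topology_subtopology_eu simp: continuous_map_in_subtopology
          intro!: continuous_map_real_min continuous_map_real_mult continuous_map_diff continuous_map_half_line_snd)
    from continuous_map_compose[OF this \<delta>(1)]
    have "continuous_map (prod_topology ?I half_line) (Map C x y)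
        (\<lambda>x. \<delta> (min (min (?w x) (2 * fst x * r - ?w x)) r))"
      by (simp add: comp_def)
    \<comment> \<open>Continuity of \<delta> is given only with its argument cut off at
      \<open>r\<close>. The path turns round at time \<open>t * r\<close>, which is at most
      \<open>r\<close>, so the extra cut-off changes nothing.\<close>
    then show "continuous_map (prod_topology ?I half_line) (Map C x y)
        (\<lambda>x. \<delta> (min (?w x) (2 * fst x * r - ?w x)))"
    proof (rule continuous_map_eq)
      fix z assume "z \<in> topspace (prod_topology ?I half_line)"
      then have "fst z * r \<le> r"
        using tr by auto
      then have "min (?w z) (2 * fst z * r - ?w z) \<le> r"
        by (auto simp: min_def)
      then show "\<delta> (min (min (?w z) (2 * fst z * r - ?w z)) r) = \<delta> (min (?w z) (2 * fst z * r - ?w z))"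
        by (simp add: min_absorb1)
    qed
  qed (use r in auto)
  then have "pathin (Map P (x, y, a) (x, y, a)) ?p"
    using o r \<delta> by (auto simp: pathin_def continuous_map_into_path_Map)
  then have "PC.htpy (x, y, a) (x, y, a) (?p 0) (?p 1)"
    unfolding path_component_of_def by (intro exI[of _ ?p]) simp
  moreover have "?p 0 = Id P (x, y, a)"
    using \<delta> by (simp add: path_Id moore_path_0)
  moreover have "?p 1 = Comp P (x, y, a) (x, y, a) (x, y, a) ((Id C x, Id C y), moore_path (\<lambda>u. \<delta> (r - u)) r)
      ((Id C x, Id C y), moore_path \<delta> r)"
  proof -
    have "moore_map (\<lambda>h. Comp C x x y h (Id C x)) (moore_path (\<lambda>u. \<delta> (r - u)) r) = moore_path (\<lambda>u. \<delta> (r - u)) r"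
      "moore_map (\<lambda>h. Comp C x y y (Id C y) h) (moore_path \<delta> r) = moore_path \<delta> r"
      unfolding moore_map_path using o r d by (auto intro!: moore_path_eqI)
    then show ?thesis
      using o r by (simp add: path_Comp moore_concat_path) (auto intro!: moore_path_eqI simp: min_def)
  qed
  ultimately show ?thesis
    by (simp only: path_component_of_sym)
qed

lemma weak_equivalence_in_loop:
  assumes ob: "(x, y, a) \<in> Ob P"
    and m: "((Id C x, Id C y), m) \<in> topspace (Map P (x, y, a) (x, y, a))"
  shows "weak_equivalence_in P (x, y, a) (x, y, a) ((Id C x, Id C y), m)"
proof -
  have o: "x \<in> Ob C" "y \<in> Ob C" "a \<in> Hom x y"
    using ob by (auto simp: Ob_path_cat weak_equivalence_in_def)
  have ms: "m \<in> topspace (moore_space T (Map C x y))" "moore_start m = a" "moore_end m = a"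
    using m o by (auto simp: topspace_path_Map)
  obtain \<delta> r where \<delta>: "m = moore_path \<delta> r" "0 \<le> r" "continuous_map half_line (Map C x y) \<delta>"
    using moore_space_cases[OF ms(1)] by blast
  have a: "\<delta> 0 = a" "\<delta> r = a"
    using ms \<delta> by auto
  have "continuous_map half_line half_line (\<lambda>u. min u r)" "continuous_map half_line half_line (\<lambda>u. r - min u r)"
    using \<delta>(2) by (auto simp: continuous_map_in_subtopology intro!: continuous_intros)
  from this[THEN continuous_map_compose, OF \<delta>(3)]
  have c: "continuous_map half_line (Map C x y) (\<lambda>u. \<delta> (min u r))"
      "continuous_map half_line (Map C x y) (\<lambda>u. \<delta> (r - min u r))"
    by (simp_all add: comp_def)
  define n where "n = moore_path (\<lambda>u. \<delta> (r - u)) r"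
  have n: "((Id C x, Id C y), n) \<in> topspace (Map P (x, y, a) (x, y, a))"
    using o \<delta>(2) a moore_path_in[OF \<delta>(2) c(2)] by (simp add: topspace_path_Map n_def)
  \<comment> \<open>Reversing twice gives the loop back, so \<open>loop_contract\<close>, applied to
    the reversed loop, contracts the composite in the other order.\<close>
  have m_eq: "m = moore_path (\<lambda>u. \<delta> (r - (r - u))) r"
    by (simp add: \<delta>)
  have "PC.htpy_inverse (x, y, a) (x, y, a) ((Id C x, Id C y), m) ((Id C x, Id C y), n)"
    unfolding PC.htpy_inverse_def
    using ob m n loop_contract[OF ob \<delta>(2) c(1) a] loop_contract[OF ob \<delta>(2), of "\<lambda>u. \<delta> (r - u)"] c(2) a
    by (simp add: n_def \<delta>(1))
  then show ?thesis
    unfolding PC.weak_equivalence_in_iff by blast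
qed

lemma weak_equivalence_in_path_endo:
  assumes ob: "(x, y, a) \<in> Ob P" and F: "((f, g), m) \<in> topspace (Map P (x, y, a) (x, y, a))"
    and "htpy x x f (Id C x)" "htpy y y g (Id C y)"
  shows "weak_equivalence_in P (x, y, a) (x, y, a) ((f, g), m)"
proof -
  obtain n where n: "PC.htpy (x, y, a) (x, y, a) ((f, g), m) ((Id C x, Id C y), n)"
    using path_Map_transport[OF ob ob F assms(3,4)] .
  then have "weak_equivalence_in P (x, y, a) (x, y, a) ((Id C x, Id C y), n)"
    by (intro weak_equivalence_in_loop ob) (simp add: path_component_of_equiv)
  then show ?thesis
    using PC.weak_equivalence_in_htpy path_component_of_sym[OF n] by blast
qed

lemma weak_equivalence_in_path_cat:
  assumes ob: "(x, y, a) \<in> Ob P" "(x', y', b) \<in> Ob P"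
    and F: "((f, g), m) \<in> topspace (Map P (x, y, a) (x', y', b))"
    and "weak_equivalence_in C x x' f" "weak_equivalence_in C y y' g"
  shows "weak_equivalence_in P (x, y, a) (x', y', b) ((f, g), m)"
proof -
  have o: "x \<in> Ob C" "y \<in> Ob C" "x' \<in> Ob C" "y' \<in> Ob C" "a \<in> Hom x y" "b \<in> Hom x' y'"
    using ob by (auto simp: Ob_path_cat weak_equivalence_in_def)
  have fg: "f \<in> Hom x x'" "g \<in> Hom y y'" and m: "m \<in> topspace (moore_space T (Map C x y'))"
    "moore_start m = Comp C x y y' g a" "moore_end m = Comp C x x' y' b f"
    using F by (auto simp: topspace_path_Map)
  obtain f' g' where f': "htpy_inverse x x' f f'" and g': "htpy_inverse y y' g g'"
    using assms by (auto simp: weak_equivalence_in_iff)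
  then have fg': "f' \<in> Hom x' x" "g' \<in> Hom y' y"
    by (auto simp: htpy_inverse_def)
  \<comment> \<open>A path for the opposite direction must join g' b to a f'. The chain is: g' b is
    homotopic to g' b f f', this to g' g a f' by the path \<open>m\<close>, and this to a
    f'.\<close>
  have "htpy x y' (Comp C x x' y' b f) (Comp C x y y' g a)"
    using path_component_of_sym[OF path_component_of_moore[OF m(1)]] m by simp
  then have "htpy x' y (Comp C x' y' y g' (Comp C x' x y' (Comp C x x' y' b f) f'))
      (Comp C x' y' y g' (Comp C x' x y' (Comp C x y y' g a) f'))"
    using o fg' by (intro htpy_Comp_left htpy_Comp_right)
  moreover have "htpy x' y (Comp C x' y' y g' (Comp C x' x' y' b (Comp C x' x x' f f')))
      (Comp C x' y' y g' (Comp C x' x' y' b (Id C x')))"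
    using o fg' f' by (intro htpy_Comp_right) (auto simp: htpy_inverse_def)
  moreover have "htpy x' y (Comp C x' y y (Comp C y y' y g' g) (Comp C x' x y a f')) (Comp C x' y y (Id C y) (Comp C x' x y a f'))"
    using o fg' g' by (intro htpy_Comp_left) (auto simp: htpy_inverse_def)
  ultimately have "htpy x' y (Comp C x' y' y g' b) (Comp C x' x y a f')"
    using o fg fg' by (simp add: Comp_assoc) (meson path_component_of_sym path_component_of_trans)
  then obtain n where n: "n \<in> topspace (moore_space T (Map C x' y))"
      "moore_start n = Comp C x' y' y g' b" "moore_end n = Comp C x' x y a f'"
    by (rule moore_path_exists)
  let ?X = "(x, y, a)" and ?Y = "(x', y', b)" and ?F = "((f, g), m)" and ?G = "((f', g'), n)"
  have G: "?G \<in> topspace (Map P ?Y ?X)"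
    using fg' n by (simp add: topspace_path_Map)
  have "Comp P ?X ?Y ?X ?G ?F \<in> topspace (Map P ?X ?X)" "Comp P ?Y ?X ?Y ?F ?G \<in> topspace (Map P ?Y ?Y)"
    using ob F G by (auto intro: PC.Comp_in_Hom)
  \<comment> \<open>The components f' f and g' g are homotopic to identities, and likewise f f' and
    g g'. The path components are arbitrary, as \<open>n\<close> was chosen by its ends alone; the
    composites are therefore weak equivalences rather than known to be homotopic to identities,
    which calls for \<open>weak_equivalence_in_two_sided\<close>.\<close>
  then have "weak_equivalence_in P ?X ?X (Comp P ?X ?Y ?X ?G ?F)" "weak_equivalence_in P ?Y ?Y (Comp P ?Y ?X ?Y ?F ?G)"
    using f' g' ob unfolding path_Comp htpy_inverse_def by (auto intro!: weak_equivalence_in_path_endo)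
  then show ?thesis
    by (rule PC.weak_equivalence_in_two_sided[OF F G])
qed

lemma dk_equivalence_path_incl: "dk_equivalence T C P (path_incl C)"
  unfolding dk_equivalence_def
proof (intro conjI ballI enriched_functor_path_incl)
  show "weak_homotopy_equivalence (Map C x y) (Map P (F0 (path_incl C) x) (F0 (path_incl C) y)) (F1 (path_incl C) x y)"
    if "x \<in> Ob C" "y \<in> Ob C" for x y
    using weak_homotopy_equivalence_path_incl[OF that] by (simp add: path_incl_def)
  show "essentially_surjective (pi0_cat C) (pi0_cat P) (F0 (path_incl C))"
    unfolding essentially_surjective_def
  proof
    fix Y assume "Y \<in> obj (pi0_cat P)"
    then obtain x y a where Y: "Y = (x, y, a)" "(x, y, a) \<in> Ob P" and a: "weak_equivalence_in C x y a"
      by (cases Y) (auto simp: pi0_cat_def Ob_path_cat)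
    have o: "x \<in> Ob C" "y \<in> Ob C" "a \<in> Hom x y"
      using a by (auto simp: weak_equivalence_in_def)
    have X: "(x, x, Id C x) \<in> Ob P"
      using o by (simp add: Ob_path_cat weak_equivalence_in_Id)
    \<comment> \<open>The square with sides id, id, a, a commutes strictly, so a constant path links
      the identity of \<open>x\<close> to the object \<open>a\<close>; its components are weak
      equivalences.\<close>
    have "((Id C x, a), moore_const a) \<in> topspace (Map P (x, x, Id C x) (x, y, a))"
      using o by (simp add: topspace_path_Map moore_const_in)
    then have "weak_equivalence_in P (x, x, Id C x) (x, y, a) ((Id C x, a), moore_const a)"
      using a o by (intro weak_equivalence_in_path_cat X Y) (auto intro: weak_equivalence_in_Id)
    then show "\<exists>c\<in>obj (pi0_cat C). \<exists>u. is_iso (pi0_cat P) (F0 (path_incl C) c) Y u"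
      using o Y unfolding weak_equivalence_in_def
      by (intro bexI[of _ x]) (auto simp: path_incl_def pi0_cat_def)
  qed
qed

lemma cat_fibration_ev: "cat_fibration T P (prod_cat T C C) (pair_functor ev_s ev_t)"
  unfolding cat_fibration_def
proof (intro conjI ballI allI impI enriched_functor_ev)
  fix X Y assume "X \<in> Ob P" "Y \<in> Ob P"
  moreover have "F1 (pair_functor ev_s ev_t) X Y = fst"
    by (auto simp: pair_functor_def ev_s_def ev_t_def)
  ultimately show "serre_fibration (Map P X Y) (Map (prod_cat T C C) (F0 (pair_functor ev_s ev_t) X)
      (F0 (pair_functor ev_s ev_t) Y)) (F1 (pair_functor ev_s ev_t) X Y)"
    using serre_fibration_ev by (cases X, cases Y) (simp add: pair_functor_def ev_s_def ev_t_def prod_cat_def)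
next
  fix X d e
  assume X: "X \<in> Ob P" and we: "weak_equivalence_in (prod_cat T C C) (F0 (pair_functor ev_s ev_t) X) d e"
  obtain x y a where X_eq: "X = (x, y, a)"
    by (cases X)
  obtain x' y' f g where de: "d = (x', y')" "e = (f, g)"
    by (metis prod.collapse)
  have ob: "(x, y, a) \<in> Ob P" and a: "weak_equivalence_in C x y a"
    using X by (auto simp: X_eq Ob_path_cat)
  have fg: "weak_equivalence_in C x x' f" "weak_equivalence_in C y y' g"
    using weak_equivalence_in_prod_cat[OF topological_category topological_category] we
    by (auto simp: X_eq de pair_functor_def ev_s_def ev_t_def)
  obtain f' where f': "htpy_inverse x x' f f'"
    using fg by (auto simp: weak_equivalence_in_iff)
  then have f'_weq: "weak_equivalence_in C x' x f'"
    using htpy_inverse_sym weak_equivalence_in_iff by blast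
  define b where "b = Comp C x' y y' g (Comp C x' x y a f')"
  have b: "weak_equivalence_in C x' y' b"
    unfolding b_def by (intro weak_equivalence_in_Comp[OF _ fg(2)] weak_equivalence_in_Comp[OF f'_weq a])
  then have ob': "(x', y', b) \<in> Ob P"
    by (simp add: Ob_path_cat)
  have o: "x \<in> Ob C" "y \<in> Ob C" "x' \<in> Ob C" "y' \<in> Ob C" "a \<in> Hom x y" "f \<in> Hom x x'" "g \<in> Hom y y'" "f' \<in> Hom x' x"
    using a fg f'_weq by (auto simp: weak_equivalence_in_def)
  \<comment> \<open>Since f' f is homotopic to the identity, g a is homotopic to g a f' f, which is
    b f; a Moore path realizing this completes (f, g) to a morphism.\<close>
  have "htpy x y' (Comp C x y y' g (Comp C x x y a (Comp C x x' x f' f))) (Comp C x y y' g (Comp C x x y a (Id C x)))"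
    using o f' by (intro htpy_Comp_right) (auto simp: htpy_inverse_def)
  then have "htpy x y' (Comp C x y y' g a) (Comp C x x' y' b f)"
    using o by (simp add: b_def Comp_assoc path_component_of_sym)
  then obtain m where m: "m \<in> topspace (moore_space T (Map C x y'))"
      "moore_start m = Comp C x y y' g a" "moore_end m = Comp C x x' y' b f"
    by (rule moore_path_exists)
  have "((f, g), m) \<in> topspace (Map P (x, y, a) (x', y', b))"
    using m o by (simp add: topspace_path_Map)
  from weak_equivalence_in_path_cat[OF ob ob' this fg]
  show "\<exists>X' e'. weak_equivalence_in P X X' e' \<and> F0 (pair_functor ev_s ev_t) X' = d \<and>
      F1 (pair_functor ev_s ev_t) X X' e' = e"
    unfolding X_eq de
    by (intro exI[of _ "(x', y', b)"] exI[of _ "((f, g), m)"]) (simp add: pair_functor_def ev_s_def ev_t_def)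
qed

end

theorem lemma2p11:
  fixes \<C> :: "('o, 'm) tcat"
  assumes "topological_category TYPE('k) \<C>"
  shows "topological_category TYPE('k) (path_cat TYPE('k) \<C>) \<and>
         path_object TYPE('k) \<C> (path_cat TYPE('k) \<C>) (path_incl \<C>) (pair_functor ev_s ev_t)"
proof -
  interpret top_category "TYPE('k)" \<C>
    by unfold_locales (rule assms)
  have "functors_agree \<C> (functor_comp (pair_functor ev_s ev_t) (path_incl \<C>)) diagonal_functor"
    by (simp add: functors_agree_def functor_comp_def pair_functor_def ev_s_def ev_t_def path_incl_def diagonal_functor_def)
  then show ?thesis
    unfolding path_object_def
    using topological_category_path_cat dk_equivalence_path_incl cat_fibration_ev by blast
qed

end
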